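(* Let $P$ and $W$ be the monads on $[\mathcal H^{\mathrm{op}},\mathbf{Set}]$ induced by the free-forgetful adjunctions $\{w,p\}\text{-}\mathbf{GAT}\leftrightarrows[\mathcal H^{\mathrm{op}},\mathbf{Set}]$ and $\{w\}\text{-}\mathbf{GAT}\leftrightarrows[\mathcal H^{\mathrm{op}},\mathbf{Set}]$ respectively. The value at $X\in[\mathcal H^{\mathrm{op}},\mathbf{Set}]$ of the underlying endofunctor $P$ agrees with $W$ on type-elements (so $PX(n)=WX(n)=\sum_{\phi\in\mathrm{Hp}(n)}[\mathcal H^{\mathrm{op}},\mathbf{Set}]([\phi],X)$), and on term-elements is given by $$\mathrm{Tm}_{PX}(\phi,h)=\mathrm{Tm}_X(h(n))+\{\pi_i:i\in[n-1],\ \phi(n)=\phi(i),\ h(n)=h(i)\}$$ for each $(\phi,h)\in PX(n)$ (under the identification given in the context).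
   Context: \textbf{Expressions and judgements.} Fix a denumerable set $\mathrm{Var}$ of variables. Given an alphabet $\Xi$, the expressions over $\Xi$ are generated as follows: each $x\in\mathrm{Var}$ is an expression; if $n\geq 0$, $e_1,\dots,e_n$ are expressions and $w\in\Xi$, then $w(e_1,\dots,e_n)$ is an expression (written $w$ when $n=0$). $\mathsf{fv}$ denotes free variables and $e'[e/x]$ substitution of $e$ for $x$ in $e'$. A context is a (possibly empty) list $x_1:T_1,\dots,x_n:T_n$ of distinct variables $x_i$ and expressions $T_i$; $\mathsf{fv}(\Gamma)$ is the set of variables occurring in $\Gamma$. A judgement is a string $\Gamma\vdash T\ \mathsf{type}$ (type judgement), $\Gamma\vdash t:T$ (term judgement), $\Gamma\vdash T=T'\ \mathsf{type}$ (type equality) or $\Gamma\vdash t=t':T$ (term equality), with $\Gamma$ a context and $t,t',T,T'$ expressions; its degree is one more than the length of $\Gamma$. The boundary of a judgement is a list of judgements: $\partial(\vdash T\ \mathsf{type})=()$; $\partial(\Gamma,x:T\vdash T'\ \mathsf{type})=(\Gamma\vdash T\ \mathsf{type})$; $\partial(\Gamma\vdash t:T)=(\Gamma\vdash T\ \mathsf{type})$; $\partial(\Gamma\vdash T=T'\ \mathsf{type})=(\Gamma\vdash T\ \mathsf{type},\ \Gamma\vdash T'\ \mathsf{type})$; $\partial(\Gamma\vdash t=t':T)=(\Gamma\vdash t:T,\ \Gamma\vdash t':T)$. \textbf{Deduction rules} (premises $\Longrightarrow$ conclusion; $\mathcal J$ stands for the right-hand side of any of the four judgement forms). \emph{Equality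 and $\alpha$ rules}: $\Gamma\vdash t:T\Longrightarrow\Gamma\vdash t=t:T$; $\Gamma\vdash t_1=t_2:T\Longrightarrow\Gamma\vdash t_2=t_1:T$; $\Gamma\vdash t_1=t_2:T$ and $\Gamma\vdash t_2=t_3:T\Longrightarrow\Gamma\vdash t_1=t_3:T$; $\Gamma\vdash T\ \mathsf{type}\Longrightarrow\Gamma\vdash T=T\ \mathsf{type}$; $\Gamma\vdash T_1=T_2\ \mathsf{type}\Longrightarrow\Gamma\vdash T_2=T_1\ \mathsf{type}$; $\Gamma\vdash T_1=T_2\ \mathsf{type}$ and $\Gamma\vdash T_2=T_3\ \mathsf{type}\Longrightarrow\Gamma\vdash T_1=T_3\ \mathsf{type}$; $\Gamma\vdash T_1=T_2\ \mathsf{type}$ and $\Gamma\vdash t:T_1\Longrightarrow\Gamma\vdash t:T_2$; $\Gamma\vdash T_1=T_2\ \mathsf{type}$ and $\Gamma\vdash t_1=t_2:T_1\Longrightarrow\Gamma\vdash t_1=t_2:T_2$; $\Gamma\vdash\mathcal J\Longrightarrow\sigma\cdot\Gamma\vdash\sigma\cdot\mathcal J$ for any permutation $\sigma\in\mathrm{Sym}(\mathrm{Var})$ acting on variables. \emph{Weakening} ($w$): $\Gamma\vdash T\ \mathsf{type}$ and $\Gamma,\Delta\vdash\mathcal J\Longrightarrow\Gamma,y:T,\Delta\vdash\mathcal J$, for $y\notin\mathsf{fv}(\Gamma)\cup\mathsf{fv}(\Delta)$. \emph{Projection} ($p$): $\Gamma\vdash T\ \mathsf{type}\Longrightarrow\Gamma,y:T\vdash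 y:T$, for $y\notin\mathsf{fv}(\Gamma)$. \textbf{$D$-GATs.} Let $D=\{w\}$ or $D=\{w,p\}$. A $D$-GAT $\mathbb T$ consists of a collection $\Omega$ of type-constants, a collection $\Sigma$ of term-constants and a collection $\Lambda$ of basic judgements over $\Omega\amalg\Sigma$ such that: for each $A\in\Omega$ there is a unique judgement in $\Lambda$ of the form $x_1:T_1,\dots,x_{n-1}:T_{n-1}\vdash A(x_1,\dots,x_{n-1})\ \mathsf{type}$; for each $f\in\Sigma$ there is a unique judgement in $\Lambda$ of the form $x_1:T_1,\dots,x_{n-1}:T_{n-1}\vdash f(x_1,\dots,x_{n-1}):T$; all other elements of $\Lambda$ are type or term equality judgements; each element of $\Lambda$ lies in $\mathbb T^*$. Here $\mathbb T^*$, the collection of derived judgements, is the smallest collection closed under the equality and $\alpha$ rules and the rules in $D$, and containing $\mathcal J\in\Lambda$ whenever it contains each judgement in $\partial(\mathcal J)$. An interpretation $\phi\colon\mathbb T\to\mathbb U$ of $D$-GATs is a function $\phi\colon\mathbb T^*\to\mathbb U^*$ preserving boundaries and preserving deduction: viewing each available rule with $n$ premises (for each choice of parameters such as $y$ or $\sigma$) as an $n$-ary partial function $r$ on judgements, $\phi(r(\mathcal J_1,\dots,\mathcal J_n))=r(\phi(\mathcal J_1),\dots,\phi(\mathcal J_n))$ whenever both sides are defined. On derived type judgements, $(x_1:S_1,\dots,x_{n-1}:S_{n-1}\vdash S_n\ \mathsf{type})\equiv(y_1:T_1,\dots,y_{m-1}:T_{m-1}\vdash T_m\ \mathsf{type})$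 iff $n=m$ and for $1\le i\le n$ the judgement $x_1:S_1,\dots,x_{i-1}:S_{i-1}\vdash S_i=T_i[x_1/y_1,\dots,x_{i-1}/y_{i-1}]\ \mathsf{type}$ is derived. On derived term judgements, $(x_1:S_1,\dots,x_{n-1}:S_{n-1}\vdash s:S_n)\equiv(y_1:T_1,\dots,y_{m-1}:T_{m-1}\vdash t:T_m)$ iff their boundaries are $\equiv$ and $x_1:S_1,\dots,x_{n-1}:S_{n-1}\vdash s=t[x_1/y_1,\dots,x_{n-1}/y_{n-1}]:S_n$ is derived. $D\text{-}\mathbf{GAT}$ has $D$-GATs as objects and, as morphisms, interpretations modulo: $\phi\sim\phi'$ iff $\phi(\mathcal J)\equiv\phi'(\mathcal J)$ for each derived type or term judgement $\mathcal J$. \textbf{Type-and-term structures and the monads.} $[a,b]=\{a,\dots,b\}\subset\mathbb N$ and $[n]=[1,n]$. $\mathcal H$ is the category freely generated by the graph with objects $n$ and $n_t$ ($n\ge1$) and arrows $n\to n+1$ and $n\to n_t$. For $X\in[\mathcal H^{\mathrm{op}},\mathbf{Set}]$ the maps $X(n+1)\to X(n)$, $X(n_t)\to X(n)$ are written $\partial$; elements of $X(n)$ are type-elements, elements of $X(n_t)$ term-elements; for $A\in X(n)$, $\mathrm{Tm}_X(A)=\{a\in X(n_t):\partial a=A\}$. The forgetful functor $V_D\colon D\text{-}\mathbf{GAT}\to[\mathcal H^{\mathrm{op}},\mathbf{Set}]$ has $V_D\mathbb T(n)$ (resp. $V_D\mathbb T(n_t)$) the set of derived type (resp. term) judgements of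 degree $n$ modulo $\equiv$, boundaries induced by $\partial$, and $V_D\phi([\mathcal J])=[\phi(\mathcal J)]$. Its left adjoint $G_D$ sends $X$ to the free $D$-GAT $G_DX$ whose type- and term-constants are the type- and term-elements of $X$ and whose basic judgements are $x_1:A_1,x_2:A_2(x_1),\dots,x_{n-1}:A_{n-1}(x_1,\dots,x_{n-2})\vdash A(x_1,\dots,x_{n-1})\ \mathsf{type}$ for $A\in X(n)$, where $A_i=\partial^{n-i}A$, and, in the same context, $\dots\vdash a(x_1,\dots,x_{n-1}):A(x_1,\dots,x_{n-1})$ for $a\in\mathrm{Tm}_X(A)$. The monads are $W=V_{\{w\}}G_{\{w\}}$ and $P=V_{\{w,p\}}G_{\{w,p\}}$. \textbf{Heaps.} A min-heap of size $n$ is a function $\phi\colon[0,n]\to[0,n]$ with $\phi(0)=0$ and $\phi(i)<i$ for $i\in[n]$; $\mathrm{Hp}(n)$ is the set of these. For $\phi\in\mathrm{Hp}(n+1)$, $\partial\phi\in\mathrm{Hp}(n)$ is its restriction to $[0,n]$. For $i\in[n]$, $\mathsf{dp}_\phi(i)=|\{\phi(i),\phi^2(i),\dots\}|$. The presheaf $[\phi]$ has $[\phi](m)=\{i\in[n]:\mathsf{dp}_\phi(i)=m\}$, $[\phi](m_t)=\emptyset$, and $\partial(i)=\phi(i)$. For $h\colon[\phi]\to X$, $\partial h$ is its restriction to $[\partial\phi]$. $W$ is described by $WX(n)=\sum_{\phi\in\mathrm{Hp}(n)}[\mathcal H^{\mathrm{op}},\mathbf{Set}]([\phi],X)$, $\partial(\phi,h)=(\partial\phi,\partial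 h)$, $\mathrm{Tm}_{WX}(\phi,h)=\mathrm{Tm}_X(h(n))$. \textbf{Identification.} $(\phi,h)$ with $\phi\in\mathrm{Hp}(n)$ corresponds to the class of the judgement $x_1:T_1,\dots,x_{n-1}:T_{n-1}\vdash T_n\ \mathsf{type}$ in which $T_i=h(i)(x_{j_1},\dots,x_{j_{k-1}})$, $k=\mathsf{dp}_\phi(i)$, $j_\ell=\phi^{k-\ell}(i)$; $a\in\mathrm{Tm}_X(h(n))$ corresponds to the class of $x_1:T_1,\dots,x_{n-1}:T_{n-1}\vdash a(x_{j_1},\dots,x_{j_{k-1}}):T_n$, with the indices $j_\ell$ for $i=n$; and $\pi_i$ corresponds to the class of $x_1:T_1,\dots,x_{n-1}:T_{n-1}\vdash x_i:T_i$ (where $T_i=T_n$). *)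

theory Defs
  imports Main "HOL-Library.FuncSet"
begin

section \<open>Expressions and judgements\<close>

type_synonym var = nat

datatype (fv: 'v, syms: 'c) expr =
  Var 'v
| App 'c "('v, 'c) expr list"

primrec subst :: "('v \<Rightarrow> ('v, 'c) expr) \<Rightarrow> ('v, 'c) expr \<Rightarrow> ('v, 'c) expr" where
  "subst s (Var x) = s x"
| "subst s (App c es) = App c (map (subst s) es)"

text \<open>\<open>rename_vars xs ys e\<close> is the simultaneous substitution e[x1/y1, x2/y2, ...].\<close>

definition rename_vars :: "'v list \<Rightarrow> 'v list \<Rightarrow> ('v, 'c) expr \<Rightarrow> ('v, 'c) expr" where
  "rename_vars xs ys =
     subst (\<lambda>v. case map_of (zip ys xs) v of None \<Rightarrow> Var v | Some x \<Rightarrow> Var x)"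

text \<open>Contexts are lists with the oldest declaration first. Distinctness of the declared
  variables is not built into the type: it is imposed on the basic judgements of a theory
  (in \<open>gat\<close> below) and preserved by every deduction rule.\<close>

type_synonym ('v, 'c) ctx = "('v \<times> ('v, 'c) expr) list"

datatype (rhs_vars: 'v, rhs_syms: 'c) rhs =
  IsType "('v, 'c) expr"
| HasType "('v, 'c) expr" "('v, 'c) expr"
| TypeEq "('v, 'c) expr" "('v, 'c) expr"
| TermEq "('v, 'c) expr" "('v, 'c) expr" "('v, 'c) expr"

datatype (judg_vars: 'v, judg_syms: 'c) judgement =
  Judg (judg_ctx: "('v \<times> ('v, 'c) expr) list") (judg_rhs: "('v, 'c) rhs")
    (infix \<open>\<turnstile>\<close> 55)

definition ctx_fv :: "('v, 'c) ctx \<Rightarrow> 'v set" where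
  "ctx_fv \<Gamma> = (\<Union>(x, T)\<in>set \<Gamma>. insert x (fv T))"

definition ctx_vars :: "('v, 'c) ctx \<Rightarrow> 'v list" where
  "ctx_vars \<Gamma> = map fst \<Gamma>"

definition degree :: "('v, 'c) judgement \<Rightarrow> nat" where
  "degree J = Suc (length (judg_ctx J))"

fun boundary :: "('v, 'c) judgement \<Rightarrow> ('v, 'c) judgement list" where
  "boundary (\<Gamma> \<turnstile> IsType T) =
     (if \<Gamma> = [] then [] else [butlast \<Gamma> \<turnstile> IsType (snd (last \<Gamma>))])"
| "boundary (\<Gamma> \<turnstile> HasType t T) = [\<Gamma> \<turnstile> IsType T]"
| "boundary (\<Gamma> \<turnstile> TypeEq T T') = [\<Gamma> \<turnstile> IsType T, \<Gamma> \<turnstile> IsType T']"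
| "boundary (\<Gamma> \<turnstile> TermEq t t' T) = [\<Gamma> \<turnstile> HasType t T, \<Gamma> \<turnstile> HasType t' T]"

section \<open>Generalised algebraic theories with a restricted set of rules\<close>

datatype deduction_rule = Weak | Proj

record ('o, 's) gat_data =
  ty_consts :: "'o set"
  tm_consts :: "'s set"
  basic :: "(var, 'o + 's) judgement set"

inductive_set derived ::
    "deduction_rule set \<Rightarrow> ('o, 's) gat_data \<Rightarrow> (var, 'o + 's) judgement set"
  for D :: "deduction_rule set" and T :: "('o, 's) gat_data" where
  tm_refl: "\<Gamma> \<turnstile> HasType t A \<in> derived D T \<Longrightarrow> \<Gamma> \<turnstile> TermEq t t A \<in> derived D T"
| tm_sym: "\<Gamma> \<turnstile> TermEq t1 t2 A \<in> derived D T \<Longrightarrow> \<Gamma> \<turnstile> TermEq t2 t1 A \<in> derived D T"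
| tm_trans: "\<lbrakk>\<Gamma> \<turnstile> TermEq t1 t2 A \<in> derived D T; \<Gamma> \<turnstile> TermEq t2 t3 A \<in> derived D T\<rbrakk>
    \<Longrightarrow> \<Gamma> \<turnstile> TermEq t1 t3 A \<in> derived D T"
| ty_refl: "\<Gamma> \<turnstile> IsType A \<in> derived D T \<Longrightarrow> \<Gamma> \<turnstile> TypeEq A A \<in> derived D T"
| ty_sym: "\<Gamma> \<turnstile> TypeEq A1 A2 \<in> derived D T \<Longrightarrow> \<Gamma> \<turnstile> TypeEq A2 A1 \<in> derived D T"
| ty_trans: "\<lbrakk>\<Gamma> \<turnstile> TypeEq A1 A2 \<in> derived D T; \<Gamma> \<turnstile> TypeEq A2 A3 \<in> derived D T\<rbrakk>
    \<Longrightarrow> \<Gamma> \<turnstile> TypeEq A1 A3 \<in> derived D T"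
| tm_conv: "\<lbrakk>\<Gamma> \<turnstile> TypeEq A1 A2 \<in> derived D T; \<Gamma> \<turnstile> HasType t A1 \<in> derived D T\<rbrakk>
    \<Longrightarrow> \<Gamma> \<turnstile> HasType t A2 \<in> derived D T"
| tm_eq_conv: "\<lbrakk>\<Gamma> \<turnstile> TypeEq A1 A2 \<in> derived D T; \<Gamma> \<turnstile> TermEq t1 t2 A1 \<in> derived D T\<rbrakk>
    \<Longrightarrow> \<Gamma> \<turnstile> TermEq t1 t2 A2 \<in> derived D T"
| alpha: "\<lbrakk>bij \<sigma>; J \<in> derived D T\<rbrakk> \<Longrightarrow> map_judgement \<sigma> id J \<in> derived D T"
| weakening: "\<lbrakk>Weak \<in> D; \<Gamma> \<turnstile> IsType A \<in> derived D T; \<Gamma> @ \<Delta> \<turnstile> R \<in> derived D T;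
      y \<notin> ctx_fv \<Gamma> \<union> ctx_fv \<Delta>\<rbrakk>
    \<Longrightarrow> \<Gamma> @ [(y, A)] @ \<Delta> \<turnstile> R \<in> derived D T"
| projection: "\<lbrakk>Proj \<in> D; \<Gamma> \<turnstile> IsType A \<in> derived D T; y \<notin> ctx_fv \<Gamma>\<rbrakk>
    \<Longrightarrow> \<Gamma> @ [(y, A)] \<turnstile> HasType (Var y) A \<in> derived D T"
| basic: "\<lbrakk>J \<in> basic T; \<forall>J'\<in>set (boundary J). J' \<in> derived D T\<rbrakk> \<Longrightarrow> J \<in> derived D T"

definition introduces_ty :: "'o \<Rightarrow> (var, 'o + 's) judgement \<Rightarrow> bool" where
  "introduces_ty A J \<longleftrightarrow> (\<exists>\<Gamma>. J = \<Gamma> \<turnstile> IsType (App (Inl A) (map Var (ctx_vars \<Gamma>))))"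

definition introduces_tm :: "'s \<Rightarrow> (var, 'o + 's) judgement \<Rightarrow> bool" where
  "introduces_tm f J \<longleftrightarrow> (\<exists>\<Gamma> A. J = \<Gamma> \<turnstile> HasType (App (Inr f) (map Var (ctx_vars \<Gamma>))) A)"

definition is_equality :: "('v, 'c) judgement \<Rightarrow> bool" where
  "is_equality J \<longleftrightarrow>
     (\<exists>\<Gamma> A B. J = \<Gamma> \<turnstile> TypeEq A B) \<or> (\<exists>\<Gamma> s t A. J = \<Gamma> \<turnstile> TermEq s t A)"

definition gat :: "deduction_rule set \<Rightarrow> ('o, 's) gat_data \<Rightarrow> bool" where
  "gat D T \<longleftrightarrow>
     D \<in> {{Weak}, {Weak, Proj}} \<and>
     (\<forall>J\<in>basic T. distinct (ctx_vars (judg_ctx J)) \<and> judg_syms J \<subseteq> ty_consts T <+> tm_consts T) \<and>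
     (\<forall>A\<in>ty_consts T. \<exists>!J. J \<in> basic T \<and> introduces_ty A J) \<and>
     (\<forall>f\<in>tm_consts T. \<exists>!J. J \<in> basic T \<and> introduces_tm f J) \<and>
     (\<forall>J\<in>basic T. (\<exists>A\<in>ty_consts T. introduces_ty A J) \<or> (\<exists>f\<in>tm_consts T. introduces_tm f J)
        \<or> is_equality J) \<and>
     basic T \<subseteq> derived D T"

section \<open>Equivalence of derived judgements\<close>

definition ty_judgs ::
    "deduction_rule set \<Rightarrow> ('o, 's) gat_data \<Rightarrow> nat \<Rightarrow> (var, 'o + 's) judgement set" where
  "ty_judgs D T n = {J \<in> derived D T. degree J = n \<and> (\<exists>\<Gamma> A. J = \<Gamma> \<turnstile> IsType A)}"

definition tm_judgs ::
    "deduction_rule set \<Rightarrow> ('o, 's) gat_data \<Rightarrow> nat \<Rightarrow> (var, 'o + 's) judgement set" where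
  "tm_judgs D T n = {J \<in> derived D T. degree J = n \<and> (\<exists>\<Gamma> t A. J = \<Gamma> \<turnstile> HasType t A)}"

text \<open>With \<open>Ss = [S_1, ..., S_n]\<close> and list positions starting at 0, position \<open>i\<close> of the telescope
  is compared in the context consisting of the first \<open>i\<close> declarations of \<open>\<Gamma>\<close>.\<close>

definition ty_equiv ::
    "deduction_rule set \<Rightarrow> ('o, 's) gat_data
       \<Rightarrow> ((var, 'o + 's) judgement \<times> (var, 'o + 's) judgement) set" where
  "ty_equiv D T =
     {(\<Gamma> \<turnstile> IsType A, \<Delta> \<turnstile> IsType B) | \<Gamma> A \<Delta> B.
        \<Gamma> \<turnstile> IsType A \<in> derived D T \<and> \<Delta> \<turnstile> IsType B \<in> derived D T \<and>
        length \<Gamma> = length \<Delta> \<and>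
        (let Ss = map snd \<Gamma> @ [A]; Ts = map snd \<Delta> @ [B] in
         \<forall>i \<le> length \<Gamma>.
           take i \<Gamma> \<turnstile>
             TypeEq (Ss ! i)
               (rename_vars (take i (ctx_vars \<Gamma>)) (take i (ctx_vars \<Delta>)) (Ts ! i)) \<in> derived D T)}"

definition tm_equiv ::
    "deduction_rule set \<Rightarrow> ('o, 's) gat_data
       \<Rightarrow> ((var, 'o + 's) judgement \<times> (var, 'o + 's) judgement) set" where
  "tm_equiv D T =
     {(\<Gamma> \<turnstile> HasType s A, \<Delta> \<turnstile> HasType t B) | \<Gamma> s A \<Delta> t B.
        \<Gamma> \<turnstile> HasType s A \<in> derived D T \<and> \<Delta> \<turnstile> HasType t B \<in> derived D T \<and>
        (\<Gamma> \<turnstile> IsType A, \<Delta> \<turnstile> IsType B) \<in> ty_equiv D T \<and>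
        \<Gamma> \<turnstile> TermEq s (rename_vars (ctx_vars \<Gamma>) (ctx_vars \<Delta>) t) A \<in> derived D T}"

section \<open>Type-and-term structures\<close>

text \<open>A presheaf on the free category \<open>H\<close> is given by sets \<open>X(n)\<close>, \<open>X(n_t)\<close> for \<open>n \<ge> 1\<close> and
  arbitrary maps \<open>ty_bd X n : X(n+1) \<rightarrow> X(n)\<close>, \<open>tm_bd X n : X(n_t) \<rightarrow> X(n)\<close>. The non-existent
  components at index 0 are empty by convention. The sets \<open>X(n)\<close> for different \<open>n\<close> need not be
  disjoint.\<close>

record ('a, 'b) psh =
  ty_el :: "nat \<Rightarrow> 'a set"
  tm_el :: "nat \<Rightarrow> 'b set"
  ty_bd :: "nat \<Rightarrow> 'a \<Rightarrow> 'a"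
  tm_bd :: "nat \<Rightarrow> 'b \<Rightarrow> 'a"

definition presheaf :: "('a, 'b) psh \<Rightarrow> bool" where
  "presheaf X \<longleftrightarrow>
     ty_el X 0 = {} \<and> tm_el X 0 = {} \<and>
     (\<forall>n\<ge>1. ty_bd X n \<in> ty_el X (Suc n) \<rightarrow> ty_el X n) \<and>
     (\<forall>n\<ge>1. tm_bd X n \<in> tm_el X n \<rightarrow> ty_el X n)"

text \<open>Components of a morphism are extensional functions, so that equality of morphisms is
  equality in HOL.\<close>

definition psh_hom ::
    "('a, 'b) psh \<Rightarrow> ('c, 'd) psh \<Rightarrow> ((nat \<Rightarrow> 'a \<Rightarrow> 'c) \<times> (nat \<Rightarrow> 'b \<Rightarrow> 'd)) set" where
  "psh_hom X Y =
     {(f, g).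
        (\<forall>n. f n \<in> ty_el X n \<rightarrow>\<^sub>E ty_el Y n) \<and>
        (\<forall>n. g n \<in> tm_el X n \<rightarrow>\<^sub>E tm_el Y n) \<and>
        (\<forall>n\<ge>1. \<forall>x\<in>ty_el X (Suc n). f n (ty_bd X n x) = ty_bd Y n (f (Suc n) x)) \<and>
        (\<forall>n\<ge>1. \<forall>x\<in>tm_el X n. f n (tm_bd X n x) = tm_bd Y n (g n x))}"

definition restrict_hom ::
    "('a, 'b) psh \<Rightarrow> (nat \<Rightarrow> 'a \<Rightarrow> 'c) \<times> (nat \<Rightarrow> 'b \<Rightarrow> 'd)
       \<Rightarrow> (nat \<Rightarrow> 'a \<Rightarrow> 'c) \<times> (nat \<Rightarrow> 'b \<Rightarrow> 'd)" where
  "restrict_hom Z h =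
     (\<lambda>n. restrict (fst h n) (ty_el Z n), \<lambda>n. restrict (snd h n) (tm_el Z n))"

definition Tm :: "('a, 'b) psh \<Rightarrow> nat \<Rightarrow> 'a \<Rightarrow> 'b set" where
  "Tm X n A = {a \<in> tm_el X n. tm_bd X n a = A}"

section \<open>The forgetful functor and the free theory, on objects\<close>

text \<open>The boundary of a class is the union of the classes of the boundaries of its members,
  that is, the common class of these boundaries.\<close>

definition forget ::
    "deduction_rule set \<Rightarrow> ('o, 's) gat_data
       \<Rightarrow> ((var, 'o + 's) judgement set, (var, 'o + 's) judgement set) psh" where
  "forget D T =
     \<lparr>ty_el = \<lambda>n. ty_judgs D T n // ty_equiv D T,
      tm_el = \<lambda>n. tm_judgs D T n // tm_equiv D T,
      ty_bd = \<lambda>n c. ty_equiv D T `` (\<Union>J\<in>c. set (boundary J)),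
      tm_bd = \<lambda>n c. ty_equiv D T `` (\<Union>J\<in>c. set (boundary J))\<rparr>"

text \<open>\<open>bd_iter X i k\<close> is the k-fold boundary \<open>X(i+k) \<rightarrow> X(i)\<close>.\<close>

primrec bd_iter :: "('a, 'b) psh \<Rightarrow> nat \<Rightarrow> nat \<Rightarrow> 'a \<Rightarrow> 'a" where
  "bd_iter X i 0 A = A"
| "bd_iter X i (Suc k) A = bd_iter X i k (ty_bd X (i + k) A)"

text \<open>Constants are tagged by their degree, because the sets \<open>X(n)\<close> may overlap.
  The i-th variable of the fixed enumeration is the number \<open>i\<close>.\<close>

definition free_ctx ::
    "('a, 'b) psh \<Rightarrow> nat \<Rightarrow> 'a \<Rightarrow> (var, (nat \<times> 'a) + (nat \<times> 'b)) ctx" where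
  "free_ctx X n A =
     map (\<lambda>i. (i, App (Inl (i, bd_iter X i (n - i) A)) (map Var [1..<i]))) [1..<n]"

definition free_ty_judg ::
    "('a, 'b) psh \<Rightarrow> nat \<Rightarrow> 'a \<Rightarrow> (var, (nat \<times> 'a) + (nat \<times> 'b)) judgement" where
  "free_ty_judg X n A = free_ctx X n A \<turnstile> IsType (App (Inl (n, A)) (map Var [1..<n]))"

definition free_tm_judg ::
    "('a, 'b) psh \<Rightarrow> nat \<Rightarrow> 'b \<Rightarrow> (var, (nat \<times> 'a) + (nat \<times> 'b)) judgement" where
  "free_tm_judg X n a =
     free_ctx X n (tm_bd X n a) \<turnstile>
       HasType (App (Inr (n, a)) (map Var [1..<n])) (App (Inl (n, tm_bd X n a)) (map Var [1..<n]))"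

definition free_gat :: "('a, 'b) psh \<Rightarrow> (nat \<times> 'a, nat \<times> 'b) gat_data" where
  "free_gat X =
     \<lparr>ty_consts = {(n, A). A \<in> ty_el X n},
      tm_consts = {(n, a). a \<in> tm_el X n},
      basic = {free_ty_judg X n A | n A. A \<in> ty_el X n}
            \<union> {free_tm_judg X n a | n a. a \<in> tm_el X n}\<rparr>"

definition free_forget ::
    "deduction_rule set \<Rightarrow> ('a, 'b) psh
       \<Rightarrow> ((var, (nat \<times> 'a) + (nat \<times> 'b)) judgement set,
           (var, (nat \<times> 'a) + (nat \<times> 'b)) judgement set) psh" where
  "free_forget D X = forget D (free_gat X)"

text \<open>The values at \<open>X\<close> of the underlying endofunctors of the two monads.\<close>

abbreviation "monad_W \<equiv> free_forget {Weak}"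
abbreviation "monad_P \<equiv> free_forget {Weak, Proj}"

lemma presheaf_ty_bd: "presheaf X \<Longrightarrow> n \<ge> 1 \<Longrightarrow> A \<in> ty_el X (Suc n) \<Longrightarrow> ty_bd X n A \<in> ty_el X n"
  unfolding presheaf_def by blast

lemma presheaf_tm_bd: "presheaf X \<Longrightarrow> a \<in> tm_el X n \<Longrightarrow> tm_bd X n a \<in> ty_el X n"
  unfolding presheaf_def by (cases n) auto

lemma boundary_free_ty_judg:
  assumes "n \<ge> 1"
  shows "boundary (free_ty_judg X (Suc n) A) = [free_ty_judg X n (ty_bd X n A)]"
proof -
  have ne: "[1..<Suc n] = [1..<n] @ [n]"
    using assms by simp
  have it: "bd_iter X i (Suc n - i) A = bd_iter X i (n - i) (ty_bd X n A)" if "i \<le> n" for i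
    using that by (simp add: Suc_diff_le)
  have "free_ctx X (Suc n) A
      = free_ctx X n (ty_bd X n A) @ [(n, App (Inl (n, ty_bd X n A)) (map Var [1..<n]))]"
    unfolding free_ctx_def ne map_append using it by auto
  then show ?thesis
    by (simp add: free_ty_judg_def)
qed

lemma free_ty_judg_derived:
  assumes "presheaf X" "A \<in> ty_el X n"
  shows "free_ty_judg X n A \<in> derived D (free_gat X)"
  using assms(2)
proof (induction n arbitrary: A)
  case 0
  then show ?case using assms(1) by (simp add: presheaf_def)
next
  case (Suc n)
  have b: "\<forall>J\<in>set (boundary (free_ty_judg X (Suc n) A)). J \<in> derived D (free_gat X)"
  proof (cases "n = 0")
    case True
    then show ?thesis by (simp add: free_ty_judg_def free_ctx_def)
  next
    case False
    then have "ty_bd X n A \<in> ty_el X n"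
      using Suc.prems by (simp add: presheaf_ty_bd[OF assms(1)])
    then show ?thesis
      using Suc.IH False boundary_free_ty_judg[of n X A] by simp
  qed
  show ?case
    by (rule derived.basic[OF _ b]) (use Suc.prems in \<open>auto simp: free_gat_def\<close>)
qed

lemma bd_iter_in:
  assumes "presheaf X" "i \<ge> 1" "A \<in> ty_el X (i + k)"
  shows "bd_iter X i k A \<in> ty_el X i"
  using assms(3)
proof (induction k arbitrary: A)
  case (Suc k)
  then have "ty_bd X (i + k) A \<in> ty_el X (i + k)"
    using assms(2) by (simp add: presheaf_ty_bd[OF assms(1)])
  then show ?case using Suc.IH by simp
qed simp

lemma free_ctx_vars [simp]: "ctx_vars (free_ctx X n A) = [1..<n]"
  by (simp add: ctx_vars_def free_ctx_def comp_def)

text \<open>The free theory is indeed a \<open>D\<close>-GAT.\<close>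

lemma gat_free_gat:
  assumes X: "presheaf X" and D: "D \<in> {{Weak}, {Weak, Proj}}"
  shows "gat D (free_gat X)"
proof -
  have tb: "tm_bd X n a \<in> ty_el X n" if "a \<in> tm_el X n" for n a
    using that by (rule presheaf_tm_bd[OF X])
  have cs: "\<Union> (syms ` snd ` set (free_ctx X n A)) \<subseteq> ty_consts (free_gat X) <+> tm_consts (free_gat X)"
    if "A \<in> ty_el X n" for n A
    using that bd_iter_in[OF X, of _ A "n - _"]
    by (auto simp: free_ctx_def free_gat_def)
  have s1: "judg_syms (free_ty_judg X n A) \<subseteq> ty_consts (free_gat X) <+> tm_consts (free_gat X)"
    if "A \<in> ty_el X n" for n A
    using that cs[OF that] by (force simp: free_ty_judg_def free_gat_def)
  have s2: "judg_syms (free_tm_judg X n a) \<subseteq> ty_consts (free_gat X) <+> tm_consts (free_gat X)"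
    if "a \<in> tm_el X n" for n a
    using that tb[OF that] cs[OF tb[OF that]] by (force simp: free_tm_judg_def free_gat_def)
  have d: "basic (free_gat X) \<subseteq> derived D (free_gat X)"
  proof
    fix J assume J: "J \<in> basic (free_gat X)"
    then consider n A where "A \<in> ty_el X n" "J = free_ty_judg X n A"
      | n a where "a \<in> tm_el X n" "J = free_tm_judg X n a"
      by (auto simp: free_gat_def)
    then show "J \<in> derived D (free_gat X)"
    proof cases
      case 1
      then show ?thesis using free_ty_judg_derived[OF X] by simp
    next
      case 2
      have "boundary J = [free_ty_judg X n (tm_bd X n a)]"
        by (simp add: 2 free_tm_judg_def free_ty_judg_def)
      then show ?thesis
        using free_ty_judg_derived[OF X tb[OF 2(1)]] derived.basic[OF J] by simp
    qed
  qed
  have i1: "introduces_ty (n, A) (free_ty_judg X n A)" for n A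
    unfolding introduces_ty_def free_ty_judg_def by (intro exI[of _ "free_ctx X n A"]) simp
  have i2: "introduces_tm (n, a) (free_tm_judg X n a)" for n a
    unfolding introduces_tm_def free_tm_judg_def
    by (intro exI[of _ "free_ctx X n (tm_bd X n a)"] exI) simp
  have v: "distinct (ctx_vars (judg_ctx J))" if "J \<in> basic (free_gat X)" for J
    using that by (auto simp: free_gat_def free_ty_judg_def free_tm_judg_def)
  have u1: "J = free_ty_judg X n A" if "J \<in> basic (free_gat X)" "introduces_ty (n, A) J" for J n A
    using that by (auto simp: free_gat_def introduces_ty_def free_ty_judg_def free_tm_judg_def)
  have u2: "J = free_tm_judg X n a" if "J \<in> basic (free_gat X)" "introduces_tm (n, a) J" for J n a
    using that by (auto simp: free_gat_def introduces_tm_def free_ty_judg_def free_tm_judg_def)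
  have e1: "\<forall>A\<in>ty_consts (free_gat X). \<exists>!J. J \<in> basic (free_gat X) \<and> introduces_ty A J"
  proof
    fix A assume "A \<in> ty_consts (free_gat X)"
    then obtain n B where A: "A = (n, B)" "B \<in> ty_el X n" by (auto simp: free_gat_def)
    then have "free_ty_judg X n B \<in> basic (free_gat X)" by (auto simp: free_gat_def)
    then show "\<exists>!J. J \<in> basic (free_gat X) \<and> introduces_ty A J"
      unfolding A using i1 u1 by blast
  qed
  have e2: "\<forall>f\<in>tm_consts (free_gat X). \<exists>!J. J \<in> basic (free_gat X) \<and> introduces_tm f J"
  proof
    fix f assume "f \<in> tm_consts (free_gat X)"
    then obtain n b where f: "f = (n, b)" "b \<in> tm_el X n" by (auto simp: free_gat_def)
    then have "free_tm_judg X n b \<in> basic (free_gat X)" by (auto simp: free_gat_def)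
    then show "\<exists>!J. J \<in> basic (free_gat X) \<and> introduces_tm f J"
      unfolding f using i2 u2 by blast
  qed
  have o: "(\<exists>A\<in>ty_consts (free_gat X). introduces_ty A J)
      \<or> (\<exists>f\<in>tm_consts (free_gat X). introduces_tm f J)" if J: "J \<in> basic (free_gat X)" for J
  proof -
    consider n A where "A \<in> ty_el X n" "J = free_ty_judg X n A"
      | n a where "a \<in> tm_el X n" "J = free_tm_judg X n a"
      using J by (auto simp: free_gat_def)
    then show ?thesis
    proof cases
      case 1
      then have "(n, A) \<in> ty_consts (free_gat X)" by (simp add: free_gat_def)
      then show ?thesis using i1 1 by blast
    next
      case 2
      then have "(n, a) \<in> tm_consts (free_gat X)" by (simp add: free_gat_def)
      then show ?thesis using i2 2 by blast
    qed
  qed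
  have sy: "judg_syms J \<subseteq> ty_consts (free_gat X) <+> tm_consts (free_gat X)"
    if J: "J \<in> basic (free_gat X)" for J
  proof -
    consider n A where "A \<in> ty_el X n" "J = free_ty_judg X n A"
      | n a where "a \<in> tm_el X n" "J = free_tm_judg X n a"
      using J by (auto simp: free_gat_def)
    then show ?thesis using s1 s2 by cases auto
  qed
  show ?thesis
    unfolding gat_def using D d v e1 e2 o sy by blast
qed

section \<open>Heaps\<close>

definition Hp :: "nat \<Rightarrow> (nat \<Rightarrow> nat) set" where
  "Hp n = {\<phi> \<in> {0..n} \<rightarrow>\<^sub>E {0..n}. \<phi> 0 = 0 \<and> (\<forall>i\<in>{1..n}. \<phi> i < i)}"

definition dp :: "(nat \<Rightarrow> nat) \<Rightarrow> nat \<Rightarrow> nat" where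
  "dp \<phi> i = card {(\<phi> ^^ k) i | k. k \<ge> 1}"

definition heap_psh :: "nat \<Rightarrow> (nat \<Rightarrow> nat) \<Rightarrow> (nat, unit) psh" where
  "heap_psh n \<phi> =
     \<lparr>ty_el = \<lambda>m. {i \<in> {1..n}. dp \<phi> i = m}, tm_el = \<lambda>_. {},
      ty_bd = \<lambda>_. \<phi>, tm_bd = \<lambda>_ _. undefined\<rparr>"

type_synonym ('a, 'b) heap_map = "(nat \<Rightarrow> nat \<Rightarrow> 'a) \<times> (nat \<Rightarrow> unit \<Rightarrow> 'b)"

definition heap_maps ::
    "nat \<Rightarrow> ('a, 'b) psh \<Rightarrow> ((nat \<Rightarrow> nat) \<times> ('a, 'b) heap_map) set" where
  "heap_maps n X = (SIGMA \<phi>:Hp n. psh_hom (heap_psh n \<phi>) X)"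

text \<open>For \<open>\<phi>\<close> of size \<open>n + 1\<close>: the pair consisting of the restrictions of \<open>\<phi>\<close> and \<open>h\<close>.\<close>

definition heap_bd ::
    "nat \<Rightarrow> (nat \<Rightarrow> nat) \<times> ('a, 'b) heap_map \<Rightarrow> (nat \<Rightarrow> nat) \<times> ('a, 'b) heap_map" where
  "heap_bd n = (\<lambda>(\<phi>, h).
     let \<phi>' = restrict \<phi> {0..n} in (\<phi>', restrict_hom (heap_psh n \<phi>') h))"

definition at_node :: "(nat \<Rightarrow> nat) \<Rightarrow> ('a, 'b) heap_map \<Rightarrow> nat \<Rightarrow> 'a" where
  "at_node \<phi> h i = fst h (dp \<phi> i) i"

section \<open>The identification\<close>

definition heap_args :: "(nat \<Rightarrow> nat) \<Rightarrow> nat \<Rightarrow> (var, 'c) expr list" where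
  "heap_args \<phi> i = map (\<lambda>l. Var ((\<phi> ^^ (dp \<phi> i - l)) i)) [1..<dp \<phi> i]"

definition heap_ty ::
    "(nat \<Rightarrow> nat) \<Rightarrow> ('a, 'b) heap_map \<Rightarrow> nat \<Rightarrow> (var, (nat \<times> 'a) + (nat \<times> 'b)) expr" where
  "heap_ty \<phi> h i = App (Inl (dp \<phi> i, at_node \<phi> h i)) (heap_args \<phi> i)"

definition heap_ctx ::
    "nat \<Rightarrow> (nat \<Rightarrow> nat) \<Rightarrow> ('a, 'b) heap_map \<Rightarrow> (var, (nat \<times> 'a) + (nat \<times> 'b)) ctx" where
  "heap_ctx n \<phi> h = map (\<lambda>i. (i, heap_ty \<phi> h i)) [1..<n]"

definition ty_ident ::
    "deduction_rule set \<Rightarrow> ('a, 'b) psh \<Rightarrow> nat \<Rightarrow> (nat \<Rightarrow> nat) \<times> ('a, 'b) heap_map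
       \<Rightarrow> (var, (nat \<times> 'a) + (nat \<times> 'b)) judgement set" where
  "ty_ident D X n = (\<lambda>(\<phi>, h).
     ty_equiv D (free_gat X) `` {heap_ctx n \<phi> h \<turnstile> IsType (heap_ty \<phi> h n)})"

text \<open>\<open>Inl a\<close> is a term-element of \<open>X\<close> over \<open>h(n)\<close>; \<open>Inr i\<close> is the formal symbol \<open>\<pi>_i\<close>.\<close>

definition tm_ident ::
    "deduction_rule set \<Rightarrow> ('a, 'b) psh \<Rightarrow> nat \<Rightarrow> (nat \<Rightarrow> nat) \<Rightarrow> ('a, 'b) heap_map
       \<Rightarrow> 'b + nat \<Rightarrow> (var, (nat \<times> 'a) + (nat \<times> 'b)) judgement set" where
  "tm_ident D X n \<phi> h z =
     tm_equiv D (free_gat X) ``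
       {heap_ctx n \<phi> h \<turnstile>
          HasType (case z of Inl a \<Rightarrow> App (Inr (dp \<phi> n, a)) (heap_args \<phi> n) | Inr i \<Rightarrow> Var i)
            (heap_ty \<phi> h n)}"

end

theory Submission
  imports Defs "HOL-Combinatorics.Transposition"
begin

text \<open>
Type theories without substitution are rigid, and this is what makes the free ones computable. A
derivable type over the free theory is a type-element applied to variables, and those variables are
declared with the types of the generic telescope of that element. Well-formedness of a type in a
well-formed context can be read off from its last argument alone
(\<open>wf_ty\<close>): its declaration must be the boundary of the type. One inclusion of
\<open>derived_iff_valid\<close> holds because every rule preserves this look-up; the other because a context
that contains more than the telescope needed can be shortened by an instance of weakening, until
only a renamed basic judgement is left. Equalities are never derivable between different
expressions, as no basic judgement is an equality.

Consequently the equivalence of judgements is equality up to a permutation of variables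
(\<open>ty_equiv_iff_alpha\<close>, \<open>tm_equiv_iff_alpha\<close>), and each class has exactly one representative
whose variables are numbered in order of declaration. In such a representative, sending a position
to the last argument of its type is a heap, and the head symbols form a map from this heap to \<open>X\<close>;
conversely a heap with such a map determines all arguments, as the chain of ancestors. This gives the
description of type-elements, and it does not depend on whether projection is available, since
projection never produces a type.

A term over a fixed numbered context and type is either a term-element with the arguments of the type,
which then must lie over the label of the last node, or, by projection, a variable declared with the
same type. Two nodes of a heap carry equal types if and only if they have the same label and the same
parent (\<open>wf_tm_heap_iff\<close>), which is the condition on the symbols \<open>\<pi>\<^sub>i\<close>.
\<close>

section \<open>Derivability in the free theory\<close>

type_synonym ('a, 'b) fexpr = "(var, (nat \<times> 'a) + (nat \<times> 'b)) expr"
type_synonym ('a, 'b) fctx = "(var, (nat \<times> 'a) + (nat \<times> 'b)) ctx"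
type_synonym ('a, 'b) fjudg = "(var, (nat \<times> 'a) + (nat \<times> 'b)) judgement"

text \<open>A type over the free theory is a type-element applied to variables. Whether it is derivable in a
well-formed context is decided by looking up its last argument only: that variable must have been
declared with the boundary of the type-element, applied to the remaining arguments. The earlier
arguments need no check of their own, since the declaration found is itself well formed. The last
argument thus points to a parent declaration, as in a heap; a type without arguments sits at the
root.\<close>

inductive wf_ty :: "('a, 'b) psh \<Rightarrow> ('a, 'b) fctx \<Rightarrow> ('a, 'b) fexpr \<Rightarrow> bool"
  for X :: "('a, 'b) psh" and \<Gamma> :: "('a, 'b) fctx" where
  root: "A \<in> ty_el X (Suc 0) \<Longrightarrow> wf_ty X \<Gamma> (App (Inl (Suc 0, A)) [])"
| child: "\<lbrakk>A \<in> ty_el X (Suc j); j \<ge> 1; (v, App (Inl (j, ty_bd X j A)) es) \<in> set \<Gamma>\<rbrakk>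
    \<Longrightarrow> wf_ty X \<Gamma> (App (Inl (Suc j, A)) (es @ [Var v]))"

inductive wf_ctx :: "('a, 'b) psh \<Rightarrow> ('a, 'b) fctx \<Rightarrow> bool" for X :: "('a, 'b) psh" where
  nil: "wf_ctx X []"
| snoc: "\<lbrakk>wf_ctx X \<Gamma>; wf_ty X \<Gamma> T; y \<notin> set (ctx_vars \<Gamma>)\<rbrakk> \<Longrightarrow> wf_ctx X (\<Gamma> @ [(y, T)])"

text \<open>No rule substitutes terms for variables, so these are the only two shapes of a term: a term-element
on exactly the arguments of its type, and, by projection, a declared variable.\<close>

inductive wf_tm ::
    "deduction_rule set \<Rightarrow> ('a, 'b) psh \<Rightarrow> ('a, 'b) fctx \<Rightarrow> ('a, 'b) fexpr \<Rightarrow> ('a, 'b) fexpr \<Rightarrow> bool"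
  for D :: "deduction_rule set" and X :: "('a, 'b) psh" and \<Gamma> :: "('a, 'b) fctx" where
  const: "a \<in> tm_el X k
    \<Longrightarrow> wf_tm D X \<Gamma> (App (Inr (k, a)) es) (App (Inl (k, tm_bd X k a)) es)"
| var: "\<lbrakk>Proj \<in> D; (y, T) \<in> set \<Gamma>\<rbrakk> \<Longrightarrow> wf_tm D X \<Gamma> (Var y) T"

text \<open>The free theory has no equality axioms, so its derivable equalities relate syntactically equal
expressions.\<close>

fun valid :: "deduction_rule set \<Rightarrow> ('a, 'b) psh \<Rightarrow> ('a, 'b) fjudg \<Rightarrow> bool" where
  "valid D X (\<Gamma> \<turnstile> IsType A) \<longleftrightarrow> wf_ctx X \<Gamma> \<and> wf_ty X \<Gamma> A"
| "valid D X (\<Gamma> \<turnstile> HasType t A) \<longleftrightarrow> wf_ctx X \<Gamma> \<and> wf_ty X \<Gamma> A \<and> wf_tm D X \<Gamma> t A"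
| "valid D X (\<Gamma> \<turnstile> TypeEq A B) \<longleftrightarrow> wf_ctx X \<Gamma> \<and> wf_ty X \<Gamma> A \<and> A = B"
| "valid D X (\<Gamma> \<turnstile> TermEq s t A) \<longleftrightarrow>
     wf_ctx X \<Gamma> \<and> wf_ty X \<Gamma> A \<and> wf_tm D X \<Gamma> s A \<and> s = t"

lemma ctx_vars_simps [simp]:
  "ctx_vars [] = []" "ctx_vars (p # \<Gamma>) = fst p # ctx_vars \<Gamma>"
  "ctx_vars (\<Gamma> @ \<Delta>) = ctx_vars \<Gamma> @ ctx_vars \<Delta>"
  "length (ctx_vars \<Gamma>) = length \<Gamma>"
  by (simp_all add: ctx_vars_def)

lemma wf_ctx_snoc [simp]:
  "wf_ctx X (\<Gamma> @ [(y, T)]) \<longleftrightarrow> wf_ctx X \<Gamma> \<and> wf_ty X \<Gamma> T \<and> y \<notin> set (ctx_vars \<Gamma>)"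
  by (auto intro: wf_ctx.snoc elim: wf_ctx.cases)

lemma wf_ty_mono: "wf_ty X \<Gamma> T \<Longrightarrow> set \<Gamma> \<subseteq> set \<Delta> \<Longrightarrow> wf_ty X \<Delta> T"
  by (induction rule: wf_ty.induct) (auto intro: wf_ty.intros)

lemma wf_tm_mono: "wf_tm D X \<Gamma> t T \<Longrightarrow> set \<Gamma> \<subseteq> set \<Delta> \<Longrightarrow> wf_tm D X \<Delta> t T"
  by (induction rule: wf_tm.induct) (auto intro: wf_tm.intros)

text \<open>A variable that does not occur in a type cannot be its last argument, so removing its declaration
does not disturb the look-up in \<^const>\<open>wf_ty\<close>.\<close>

lemma wf_ty_strengthen:
  assumes "wf_ty X (\<Gamma> @ (y, B) # \<Delta>) T" "y \<notin> fv T"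
  shows "wf_ty X (\<Gamma> @ \<Delta>) T"
  using assms by (induction rule: wf_ty.induct) (auto intro: wf_ty.intros)

lemma distinct_wf_ctx: "wf_ctx X \<Gamma> \<Longrightarrow> distinct (ctx_vars \<Gamma>)"
  by (induction rule: wf_ctx.induct) auto

lemma wf_ctx_prefix: "wf_ctx X (\<Gamma> @ \<Delta>) \<Longrightarrow> wf_ctx X \<Gamma>"
proof (induction \<Delta> rule: rev_induct)
  case (snoc p \<Delta>)
  then show ?case using wf_ctx_snoc[of X "\<Gamma> @ \<Delta>" "fst p" "snd p"] by simp
qed simp

lemma wf_ctx_declaration: "wf_ctx X (\<Gamma> @ (y, T) # \<Delta>) \<Longrightarrow> wf_ctx X \<Gamma> \<and> wf_ty X \<Gamma> T"
  using wf_ctx_prefix[of X "\<Gamma> @ [(y, T)]" \<Delta>] by simp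

lemma wf_ctx_unique:
  "wf_ctx X \<Gamma> \<Longrightarrow> (v, B) \<in> set \<Gamma> \<Longrightarrow> (v, C) \<in> set \<Gamma> \<Longrightarrow> B = C"
  using distinct_wf_ctx eq_key_imp_eq_value unfolding ctx_vars_def by fast

lemma fv_subset_if_declared:
  assumes "wf_ty X \<Gamma> T" "\<And>v B. (v, B) \<in> set \<Gamma> \<Longrightarrow> fv B \<subseteq> set (ctx_vars \<Gamma>)"
  shows "fv T \<subseteq> set (ctx_vars \<Gamma>)"
  using assms(1)
proof cases
  case (child A j v es)
  have "v \<in> set (ctx_vars \<Gamma>)"
    using child(4) by (force simp: ctx_vars_def)
  then show ?thesis using child(1) assms(2)[OF child(4)] by simp
qed simp

lemma fv_declared: "wf_ctx X \<Gamma> \<Longrightarrow> (v, B) \<in> set \<Gamma> \<Longrightarrow> fv B \<subseteq> set (ctx_vars \<Gamma>)"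
proof (induction arbitrary: v B rule: wf_ctx.induct)
  case (snoc \<Gamma> T y)
  then show ?case using fv_subset_if_declared[OF snoc.hyps(2)] by fastforce
qed simp

lemma fv_wf_ty: "wf_ctx X \<Gamma> \<Longrightarrow> wf_ty X \<Gamma> T \<Longrightarrow> fv T \<subseteq> set (ctx_vars \<Gamma>)"
  by (rule fv_subset_if_declared) (auto dest: fv_declared)

lemma fv_wf_tm: "wf_ctx X \<Gamma> \<Longrightarrow> wf_ty X \<Gamma> T \<Longrightarrow> wf_tm D X \<Gamma> t T \<Longrightarrow> fv t \<subseteq> set (ctx_vars \<Gamma>)"
  by (erule wf_tm.cases) (use fv_wf_ty in \<open>force simp: ctx_vars_def\<close>)+

lemma ctx_fv_eq: "ctx_fv \<Gamma> = set (ctx_vars \<Gamma>) \<union> (\<Union>(x, T)\<in>set \<Gamma>. fv T)"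
  by (induction \<Gamma>) (auto simp: ctx_fv_def)

lemma ctx_fv_wf: "wf_ctx X \<Gamma> \<Longrightarrow> ctx_fv \<Gamma> = set (ctx_vars \<Gamma>)"
  unfolding ctx_fv_eq using fv_declared by blast

text \<open>The variables of a well-formed type are closed under ancestors: the type declared for an argument
only uses arguments of the same type. Together they form the telescope over which the head symbol
was introduced. This step reduces the claim for a type to the claim for the declaration of its last
argument, from which all other arguments are inherited.\<close>

lemma fv_closed_step:
  assumes "wf_ctx X \<Gamma>" "wf_ty X \<Gamma> T" "(v, B) \<in> set \<Gamma>" "v \<in> fv T"
    and "\<And>w C. (w, C) \<in> set \<Gamma> \<Longrightarrow> v \<in> fv C \<Longrightarrow> fv B \<subseteq> fv C"
  shows "fv B \<subseteq> fv T"
  using assms(2)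
proof cases
  case (root A)
  then show ?thesis using assms(4) by simp
next
  case (child A j w es)
  show ?thesis
  proof (cases "v = w")
    case True
    then show ?thesis using child wf_ctx_unique[OF assms(1,3)] by fastforce
  next
    case False
    then have "v \<in> fv (App (Inl (j, ty_bd X j A) :: (nat \<times> 'a) + (nat \<times> 'b)) es)"
      using assms(4) child by simp
    then show ?thesis using assms(5)[OF child(4)] child by auto
  qed
qed

lemma fv_closed_ctx:
  "wf_ctx X \<Gamma> \<Longrightarrow> (v, B) \<in> set \<Gamma> \<Longrightarrow> (w, C) \<in> set \<Gamma> \<Longrightarrow> v \<in> fv C \<Longrightarrow> fv B \<subseteq> fv C"
proof (induction arbitrary: w C rule: wf_ctx.induct)
  case (snoc \<Gamma> T y)
  have "v \<in> set (ctx_vars \<Gamma>)"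
    using snoc.prems(2,3) fv_declared[OF snoc.hyps(1), of w C] fv_wf_ty[OF snoc.hyps(1,2)] by auto
  then have v: "(v, B) \<in> set \<Gamma>"
    using snoc.prems(1) snoc.hyps(3) by auto
  show ?case
  proof (cases "(w, C) \<in> set \<Gamma>")
    case True
    then show ?thesis using snoc v by blast
  next
    case False
    then have "C = T" using snoc.prems(2) by simp
    then show ?thesis using fv_closed_step[OF snoc.hyps(1,2) v] snoc.prems(3) snoc.IH v by blast
  qed
qed simp

lemma fv_closed:
  "wf_ctx X \<Gamma> \<Longrightarrow> wf_ty X \<Gamma> T \<Longrightarrow> (v, B) \<in> set \<Gamma> \<Longrightarrow> v \<in> fv T \<Longrightarrow> fv B \<subseteq> fv T"
  using fv_closed_step fv_closed_ctx by blast

lemma wf_ctx_weaken: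
  assumes "wf_ty X \<Gamma> A"
  shows "wf_ctx X (\<Gamma> @ \<Delta>) \<Longrightarrow> y \<notin> set (ctx_vars (\<Gamma> @ \<Delta>)) \<Longrightarrow> wf_ctx X (\<Gamma> @ (y, A) # \<Delta>)"
proof (induction \<Delta> rule: rev_induct)
  case Nil
  then show ?case using assms by simp
next
  case (snoc p \<Delta>)
  obtain z C where p: "p = (z, C)" by fastforce
  have *: "wf_ctx X (\<Gamma> @ \<Delta>) \<and> wf_ty X (\<Gamma> @ \<Delta>) C \<and> z \<notin> set (ctx_vars (\<Gamma> @ \<Delta>))"
    using snoc.prems(1) wf_ctx_snoc[of X "\<Gamma> @ \<Delta>" z C] by (simp add: p)
  have "wf_ty X (\<Gamma> @ (y, A) # \<Delta>) C"
    using * by (auto intro: wf_ty_mono)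
  then show ?case
    using * snoc wf_ctx_snoc[of X "\<Gamma> @ (y, A) # \<Delta>" z C] by (auto simp: p)
qed

lemma wf_ctx_strengthen:
  "wf_ctx X (\<Gamma> @ (y, B) # \<Delta>) \<Longrightarrow> (\<And>z C. (z, C) \<in> set \<Delta> \<Longrightarrow> y \<notin> fv C) \<Longrightarrow> wf_ctx X (\<Gamma> @ \<Delta>)"
proof (induction \<Delta> rule: rev_induct)
  case (snoc p \<Delta>)
  obtain z C where p: "p = (z, C)" by fastforce
  show ?case
    using snoc wf_ctx_snoc[of X "\<Gamma> @ \<Delta>" z C] wf_ctx_snoc[of X "\<Gamma> @ (y, B) # \<Delta>" z C]
      wf_ty_strengthen[of X \<Gamma> y B \<Delta> C]
    by (auto simp: p)
qed simp

lemma wf_ty_rename: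
  "wf_ty X \<Gamma> T \<Longrightarrow> wf_ty X (map (map_prod \<sigma> (map_expr \<sigma> id)) \<Gamma>) (map_expr \<sigma> id T)"
proof (induction rule: wf_ty.induct)
  case (child A j v es)
  have "(\<sigma> v, App (Inl (j, ty_bd X j A)) (map (map_expr \<sigma> id) es))
      \<in> set (map (map_prod \<sigma> (map_expr \<sigma> id)) \<Gamma>)"
    using child(3) by force
  from wf_ty.child[OF child(1,2) this] show ?case by (simp add: id_def)
qed (simp add: wf_ty.root)

lemma wf_ctx_rename:
  "wf_ctx X \<Gamma> \<Longrightarrow> inj \<sigma> \<Longrightarrow> wf_ctx X (map (map_prod \<sigma> (map_expr \<sigma> id)) \<Gamma>)"
  by (induction rule: wf_ctx.induct)
    (auto intro: wf_ctx.nil wf_ty_rename simp: ctx_vars_def inj_eq image_iff)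

lemma wf_tm_rename:
  "wf_tm D X \<Gamma> t T
    \<Longrightarrow> wf_tm D X (map (map_prod \<sigma> (map_expr \<sigma> id)) \<Gamma>) (map_expr \<sigma> id t) (map_expr \<sigma> id T)"
  by (induction rule: wf_tm.induct) (force intro: wf_tm.intros)+

lemma valid_rename: "valid D X J \<Longrightarrow> inj \<sigma> \<Longrightarrow> valid D X (map_judgement \<sigma> id J)"
  by (induction D X J rule: valid.induct) (auto intro: wf_ty_rename wf_ctx_rename wf_tm_rename)

text \<open>Weakening is harmless because \<^const>\<open>wf_ty\<close> and \<^const>\<open>wf_tm\<close> only ask for the presence of
declarations in the context.\<close>

lemma valid_weaken:
  assumes "valid D X (\<Gamma> @ \<Delta> \<turnstile> R)" "wf_ty X \<Gamma> A" "y \<notin> ctx_fv \<Gamma> \<union> ctx_fv \<Delta>"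
  shows "valid D X (\<Gamma> @ (y, A) # \<Delta> \<turnstile> R)"
proof -
  have "y \<notin> set (ctx_vars (\<Gamma> @ \<Delta>))"
    using assms(3) by (auto simp: ctx_fv_eq)
  then have "wf_ctx X (\<Gamma> @ \<Delta>) \<Longrightarrow> wf_ctx X (\<Gamma> @ (y, A) # \<Delta>)"
    using wf_ctx_weaken[OF assms(2)] by blast
  moreover have "wf_ty X (\<Gamma> @ \<Delta>) T \<Longrightarrow> wf_ty X (\<Gamma> @ (y, A) # \<Delta>) T" for T
    by (erule wf_ty_mono) auto
  moreover have "wf_tm D X (\<Gamma> @ \<Delta>) t T \<Longrightarrow> wf_tm D X (\<Gamma> @ (y, A) # \<Delta>) t T" for t T
    by (erule wf_tm_mono) auto
  ultimately show ?thesis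
    using assms(1) by (cases R) simp_all
qed

lemma free_ctx_Suc:
  assumes "n \<ge> 1"
  shows "free_ctx X (Suc n) A
    = free_ctx X n (ty_bd X n A) @ [(n, App (Inl (n, ty_bd X n A)) (map Var [1..<n]))]"
proof -
  have "bd_iter X i (Suc n - i) A = bd_iter X i (n - i) (ty_bd X n A)" if "i \<le> n" for i
    using that by (simp add: Suc_diff_le)
  then show ?thesis
    using assms unfolding free_ctx_def by (auto simp: less_imp_le)
qed

text \<open>The boundary of a basic type judgement of degree \<open>m + 1\<close> declares, as its own type, exactly what the
look-up for the last variable \<open>m\<close> has to find.\<close>

lemma valid_free_ty:
  assumes "presheaf X" "A \<in> ty_el X n"
    and "\<forall>J\<in>set (boundary (free_ty_judg X n A)). valid D X J"
  shows "valid D X (free_ty_judg X n A)"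
proof -
  consider "n = 0" | "n = 1" | m where "n = Suc m" "m \<ge> 1" by (cases n; cases "n - 1") auto
  then show ?thesis
  proof cases
    case 1
    then show ?thesis using assms(1,2) by (simp add: presheaf_def)
  next
    case 2
    then show ?thesis using assms(2) wf_ty.root[of A X]
      by (simp add: free_ty_judg_def free_ctx_def wf_ctx.nil)
  next
    case 3
    have "valid D X (free_ty_judg X m (ty_bd X m A))"
      using assms(3) 3 boundary_free_ty_judg[of m X A] by simp
    then show ?thesis
      using 3 assms(2) wf_ty.child[of A X m m "map Var [1..<m]" "free_ctx X n A"]
      by (simp add: free_ty_judg_def free_ctx_Suc)
  qed
qed

lemma derived_imp_valid:
  assumes X: "presheaf X"
  shows "J \<in> derived D (free_gat X) \<Longrightarrow> valid D X J"
proof (induction rule: derived.induct)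
  case (alpha \<sigma> J)
  then show ?case using valid_rename bij_is_inj by blast
next
  case (weakening \<Gamma> A \<Delta> R y)
  then show ?case using valid_weaken[of D X \<Gamma> \<Delta> R A y] by simp
next
  case (projection \<Gamma> A y)
  have "y \<notin> set (ctx_vars \<Gamma>)"
    using projection.hyps(3) by (auto simp: ctx_fv_eq)
  then show ?case
    using projection by (auto intro: wf_ty_mono wf_tm.var)
next
  case (basic J)
  then consider n A where "A \<in> ty_el X n" "J = free_ty_judg X n A"
    | n a where "a \<in> tm_el X n" "J = free_tm_judg X n a"
    by (auto simp: free_gat_def)
  then show ?case
  proof cases
    case 1
    then show ?thesis using valid_free_ty[OF X] basic by blast
  next
    case 2
    then have "valid D X (free_ty_judg X n (tm_bd X n a))"
      using basic by (simp add: free_tm_judg_def free_ty_judg_def)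
    then show ?thesis
      using 2 by (simp add: free_tm_judg_def free_ty_judg_def wf_tm.const)
  qed
qed auto

text \<open>The \<open>\<alpha>\<close> rule renames by permutations of all variables, while renamings are usually prescribed on a
context only. They extend: each new pair of variables is matched by one further transposition,
which leaves the earlier ones untouched.\<close>

lemma ex_permutation_map:
  fixes xs ys :: "'c list"
  assumes "distinct xs" "distinct ys" "length xs = length ys"
  shows "\<exists>\<sigma>. bij \<sigma> \<and> map \<sigma> xs = ys"
  using assms(3,1,2)
proof (induction xs ys rule: list_induct2)
  case Nil
  show ?case by (intro exI[of _ id]) (simp add: bij_def)
next
  case (Cons x xs y ys)
  then obtain \<sigma> where \<sigma>: "bij \<sigma>" "map \<sigma> xs = ys" by auto
  have "\<sigma> z \<noteq> \<sigma> x \<and> \<sigma> z \<noteq> y" if "z \<in> set xs" for z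
    using that \<sigma> Cons.prems bij_is_inj[OF \<sigma>(1)] by (auto simp: inj_eq)
  then have "map (transpose (\<sigma> x) y \<circ> \<sigma>) (x # xs) = y # ys"
    using \<sigma>(2) by auto
  then show ?case
    using bij_comp[OF \<sigma>(1) bij_transpose] by (intro exI conjI)
qed

text \<open>If a type uses every variable of its context, then there is no room for branching: each declaration
is the parent of the next one. The context is then the generic telescope of the head symbol, with
the \<open>i\<close>-th variable of the enumeration renamed to the \<open>i\<close>-th declared one.\<close>

lemma free_judgement_instance:
  assumes "wf_ctx X \<Gamma>" "wf_ty X \<Gamma> (App (Inl (k, A)) es)"
    and "set (ctx_vars \<Gamma>) \<subseteq> fv (App (Inl (k, A) :: (nat \<times> 'a) + (nat \<times> 'b)) es)"
    and "map \<sigma> [1..<Suc (length \<Gamma>)] = ctx_vars \<Gamma>"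
  shows "A \<in> ty_el X k \<and> k = Suc (length \<Gamma>) \<and> es = map Var (map \<sigma> [1..<k])
    \<and> \<Gamma> = map (map_prod \<sigma> (map_expr \<sigma> id)) (free_ctx (X :: ('a, 'b) psh) k A)"
  using assms
proof (induction arbitrary: k A es rule: wf_ctx.induct)
  case nil
  from nil.prems(1) show ?case
    by cases (auto simp: free_ctx_def)
next
  case (snoc \<Gamma> T y)
  have ny: "y \<notin> fv U" if "wf_ty X \<Gamma> U" for U
    using that fv_wf_ty[OF snoc.hyps(1)] snoc.hyps(3) by blast
  \<comment> \<open>The newest variable is used, so it is the last argument.\<close>
  have no: "\<not> wf_ty X \<Gamma> (App (Inl (k, A)) es)"
    using ny snoc.prems(2) by fastforce
  from snoc.prems(1) show ?case
  proof cases
    case root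
    then show ?thesis using no wf_ty.root[of A X \<Gamma>] by simp
  next
    case (child j v us)
    then have v: "v = y \<and> T = App (Inl (j, ty_bd X j A)) us"
      using no wf_ty.child[of A X j v us \<Gamma>] by auto
    have T: "wf_ty X \<Gamma> (App (Inl (j, ty_bd X j A)) us)"
      using snoc.hyps(2) v by simp
    have vars: "set (ctx_vars \<Gamma>) \<subseteq> fv T"
      using snoc.prems(2) snoc.hyps(3) child v by auto
    have \<sigma>: "map \<sigma> [1..<Suc (length \<Gamma>)] = ctx_vars \<Gamma>" "\<sigma> (Suc (length \<Gamma>)) = y"
      using snoc.prems(3) by auto
    have IH: "j = Suc (length \<Gamma>)" "us = map Var (map \<sigma> [1..<j])"
        "\<Gamma> = map (map_prod \<sigma> (map_expr \<sigma> id)) (free_ctx X j (ty_bd X j A))"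
      using snoc.IH[OF T _ \<sigma>(1)] vars v by blast+
    have \<sigma>j: "\<sigma> j = y"
      using IH(1) \<sigma>(2) by simp
    have "map (map_prod \<sigma> (map_expr \<sigma> id)) (free_ctx X k A)
        = map (map_prod \<sigma> (map_expr \<sigma> id)) (free_ctx X j (ty_bd X j A))
          @ [(y, App (Inl (j, ty_bd X j A)) (map Var (map \<sigma> [1..<j])))]"
      using child(1,4) free_ctx_Suc[of j X A] \<sigma>j by (simp add: child(1))
    also have "\<dots> = \<Gamma> @ [(y, T)]"
      using v by (simp only: IH(2) IH(3)[symmetric])
    finally have ctx: "map (map_prod \<sigma> (map_expr \<sigma> id)) (free_ctx X k A) = \<Gamma> @ [(y, T)]" .
    have es: "es = map Var (map \<sigma> [1..<k])"
      using child(1,2,4) IH(2) v \<sigma>j by simp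
    have "A \<in> ty_el X k" "k = Suc (length (\<Gamma> @ [(y, T)]))"
      using child(1,3) IH(1) by simp_all
    then show ?thesis
      by (intro conjI es ctx[symmetric])
  qed
qed

text \<open>The right-hand sides with type \<open>T\<close> that are instances of basic judgements; they mention the variables
of \<open>T\<close> and no others, which lets types and terms be derived by one induction.\<close>

definition generic_rhs :: "('a, 'b) psh \<Rightarrow> ('a, 'b) fexpr \<Rightarrow> (var, (nat \<times> 'a) + (nat \<times> 'b)) rhs set"
  where "generic_rhs X T = insert (IsType T)
    {HasType (App (Inr (k, a)) es) T | k a es. a \<in> tm_el X k \<and> T = App (Inl (k, tm_bd X k a)) es}"

text \<open>Induction on the length of the context. If the type uses every declared variable, the judgement is a
renamed basic judgement. Otherwise the last unused declaration can be introduced by weakening: all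
later declarations are arguments of the type, hence by closure under ancestors they do not mention
it either, and the judgement without it is well formed in a shorter context.\<close>

lemma derived_generic:
  assumes X: "presheaf X" and D: "Weak \<in> D"
  shows "wf_ctx X \<Gamma> \<Longrightarrow> wf_ty X \<Gamma> T \<Longrightarrow> R \<in> generic_rhs X T
    \<Longrightarrow> \<Gamma> \<turnstile> R \<in> derived D (free_gat X)"
proof (induction "length \<Gamma>" arbitrary: \<Gamma> T R rule: less_induct)
  case less
  show ?case
  proof (cases "set (ctx_vars \<Gamma>) \<subseteq> fv T")
    case True
    obtain k A es where T: "T = App (Inl (k, A)) es"
      using less.prems(2) by cases auto
    obtain \<sigma> where \<sigma>: "bij \<sigma>" "map \<sigma> [1..<Suc (length \<Gamma>)] = ctx_vars \<Gamma>"
      using ex_permutation_map[of "[1..<Suc (length \<Gamma>)]" "ctx_vars \<Gamma>"]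
        distinct_wf_ctx[OF less.prems(1)] by (auto simp del: upt_Suc)
    note inst = free_judgement_instance[OF less.prems(1) _ _ \<sigma>(2), of k A es]
    have inst: "A \<in> ty_el X k" "es = map Var (map \<sigma> [1..<k])"
        "\<Gamma> = map (map_prod \<sigma> (map_expr \<sigma> id)) (free_ctx X k A)"
      using inst less.prems(2) True T by blast+
    from less.prems(3) consider "R = IsType T"
      | a where "a \<in> tm_el X k" "A = tm_bd X k a" "R = HasType (App (Inr (k, a)) es) T"
      unfolding generic_rhs_def T by auto
    then have "\<exists>J\<in>derived D (free_gat X). \<Gamma> \<turnstile> R = map_judgement \<sigma> id J"
    proof cases
      case 1
      have "\<Gamma> \<turnstile> R = map_judgement \<sigma> id (free_ty_judg X k A)"
        unfolding 1 T free_ty_judg_def by (simp add: inst(2) inst(3)[symmetric])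
      then show ?thesis using free_ty_judg_derived[OF X inst(1)] by blast
    next
      case 2
      have "free_tm_judg X k a \<in> basic (free_gat X)"
        using 2 by (auto simp: free_gat_def)
      then have "free_tm_judg X k a \<in> derived D (free_gat X)"
        using free_ty_judg_derived[OF X inst(1), of D] 2
        by (intro derived.basic) (simp_all add: free_tm_judg_def free_ty_judg_def)
      moreover have "\<Gamma> \<turnstile> R = map_judgement \<sigma> id (free_tm_judg X k a)"
        unfolding 2 T free_tm_judg_def
        by (simp add: inst(2) inst(3)[symmetric] 2(2)[symmetric])
      ultimately show ?thesis by blast
    qed
    then show ?thesis using derived.alpha[OF \<sigma>(1)] by auto
  next
    case False
    then have "\<exists>p\<in>set \<Gamma>. fst p \<notin> fv T" by (auto simp: ctx_vars_def)
    from split_list_last_prop[OF this] obtain \<Gamma>1 y B \<Gamma>2 where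
      \<Gamma>: "\<Gamma> = \<Gamma>1 @ (y, B) # \<Gamma>2" and y: "y \<notin> fv T" and \<Gamma>2: "\<forall>p\<in>set \<Gamma>2. fst p \<in> fv T"
      by auto
    have "y \<notin> fv C" if "(z, C) \<in> set \<Gamma>2" for z C
      using fv_closed[OF less.prems(1,2), of z C] that \<Gamma>2 y \<Gamma> by fastforce
    then have ctx: "wf_ctx X (\<Gamma>1 @ \<Gamma>2)" "y \<notin> (\<Union>(z, C)\<in>set \<Gamma>2. fv C)"
      using wf_ctx_strengthen[of X \<Gamma>1 y B \<Gamma>2] less.prems(1) by (auto simp: \<Gamma>)
    have ty: "wf_ty X (\<Gamma>1 @ \<Gamma>2) T"
      using wf_ty_strengthen less.prems(2) \<Gamma> y by blast
    have B: "wf_ctx X \<Gamma>1" "wf_ty X \<Gamma>1 B"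
      using wf_ctx_declaration less.prems(1) \<Gamma> by blast+
    have d1: "\<Gamma>1 \<turnstile> IsType B \<in> derived D (free_gat X)"
      using less.hyps[OF _ B] by (simp add: \<Gamma> generic_rhs_def)
    have d2: "\<Gamma>1 @ \<Gamma>2 \<turnstile> R \<in> derived D (free_gat X)"
      using less.hyps[OF _ ctx(1) ty less.prems(3)] by (simp add: \<Gamma>)
    have "y \<notin> set (ctx_vars (\<Gamma>1 @ \<Gamma>2))"
      using distinct_wf_ctx[OF less.prems(1)] by (simp add: \<Gamma>)
    then have "y \<notin> ctx_fv \<Gamma>1 \<union> ctx_fv \<Gamma>2"
      using ctx(2) ctx_fv_wf[OF B(1)] by (auto simp: ctx_fv_eq)
    then show ?thesis using derived.weakening[OF D d1 d2] by (simp add: \<Gamma>)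
  qed
qed

text \<open>Projection yields a variable declared last; the declarations after it are added by weakening at the
end of the context.\<close>

lemma derived_var:
  assumes X: "presheaf X" and D: "Weak \<in> D" "Proj \<in> D"
  shows "wf_ctx X \<Gamma> \<Longrightarrow> (y, T) \<in> set \<Gamma> \<Longrightarrow> \<Gamma> \<turnstile> HasType (Var y) T \<in> derived D (free_gat X)"
proof (induction rule: wf_ctx.induct)
  case (snoc \<Gamma> U z)
  have U: "\<Gamma> \<turnstile> IsType U \<in> derived D (free_gat X)"
    using derived_generic[OF X D(1)] snoc.hyps by (simp add: generic_rhs_def)
  have z: "z \<notin> ctx_fv \<Gamma>" using ctx_fv_wf snoc.hyps by blast
  show ?case
  proof (cases "(y, T) \<in> set \<Gamma>")
    case True
    then show ?thesis
      using derived.weakening[OF D(1) U, of "[]"] snoc.IH z by (simp add: ctx_fv_def)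
  next
    case False
    then show ?thesis using derived.projection[OF D(2) U z] snoc.prems by simp
  qed
qed simp

text \<open>The semantic core: derivability in the free theory is decided by the context look-ups of
\<^const>\<open>valid\<close>.\<close>

theorem derived_iff_valid:
  assumes X: "presheaf X" and D: "Weak \<in> D"
  shows "J \<in> derived D (free_gat X) \<longleftrightarrow> valid D X J"
proof
  have ty: "\<Gamma> \<turnstile> IsType T \<in> derived D (free_gat X)" if "wf_ctx X \<Gamma>" "wf_ty X \<Gamma> T" for \<Gamma> T
    using that derived_generic[OF X D] by (simp add: generic_rhs_def)
  have tm: "\<Gamma> \<turnstile> HasType t T \<in> derived D (free_gat X)"
    if "wf_ctx X \<Gamma>" "wf_ty X \<Gamma> T" "wf_tm D X \<Gamma> t T" for \<Gamma> t T
    using that(3)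
  proof cases
    case (const a k es)
    then show ?thesis using that derived_generic[OF X D] by (auto simp: generic_rhs_def)
  next
    case (var y)
    then show ?thesis using derived_var[OF X D _ that(1)] by simp
  qed
  assume "valid D X J"
  then show "J \<in> derived D (free_gat X)"
    using ty tm by (cases "(D, X, J)" rule: valid.cases)
      (auto intro: derived.ty_refl derived.tm_refl)
qed (rule derived_imp_valid[OF X])

section \<open>Equivalence of judgements is renaming\<close>

definition alpha_equiv :: "(var, 'c) judgement \<Rightarrow> (var, 'c) judgement \<Rightarrow> bool" where
  "alpha_equiv J J' \<longleftrightarrow> (\<exists>\<sigma>. bij \<sigma> \<and> J = map_judgement \<sigma> id J')"

definition ty_valid :: "('a, 'b) psh \<Rightarrow> ('a, 'b) fjudg set" where
  "ty_valid X = {\<Gamma> \<turnstile> IsType A | \<Gamma> A. wf_ctx X \<Gamma> \<and> wf_ty X \<Gamma> A}"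

definition tm_valid :: "deduction_rule set \<Rightarrow> ('a, 'b) psh \<Rightarrow> ('a, 'b) fjudg set" where
  "tm_valid D X = {\<Gamma> \<turnstile> HasType t A | \<Gamma> t A. wf_ctx X \<Gamma> \<and> wf_ty X \<Gamma> A \<and> wf_tm D X \<Gamma> t A}"

lemma alpha_equiv_refl: "alpha_equiv J J"
  unfolding alpha_equiv_def using bij_id judgement.map_id by metis

lemma alpha_equiv_rename: "bij \<sigma> \<Longrightarrow> alpha_equiv (map_judgement \<sigma> id J) J"
  unfolding alpha_equiv_def by blast

lemma alpha_equiv_sym: "alpha_equiv J J' \<Longrightarrow> alpha_equiv J' J"
proof -
  assume "alpha_equiv J J'"
  then obtain \<sigma> where \<sigma>: "bij \<sigma>" "J = map_judgement \<sigma> id J'"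
    unfolding alpha_equiv_def by blast
  have "map_judgement (inv \<sigma>) id J = map_judgement (inv \<sigma> \<circ> \<sigma>) (id \<circ> id) J'"
    unfolding \<sigma>(2) judgement.map_comp ..
  also have "\<dots> = J'"
    using bij_is_inj[OF \<sigma>(1)] by (simp add: judgement.map_id del: id_apply)
  finally show ?thesis
    unfolding alpha_equiv_def using bij_imp_bij_inv[OF \<sigma>(1)] by metis
qed

lemma alpha_equiv_trans: "alpha_equiv J K \<Longrightarrow> alpha_equiv K L \<Longrightarrow> alpha_equiv J L"
  unfolding alpha_equiv_def using judgement.map_comp bij_comp by (metis comp_id)

lemma rename_vars_eq_map_expr:
  "fv e \<subseteq> set ys \<Longrightarrow> rename_vars (map \<sigma> ys) ys e = map_expr \<sigma> id e"
  unfolding rename_vars_def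
  by (induction e) (auto simp: map_of_zip_map id_def)

lemma wf_telescope:
  assumes "wf_ctx X \<Gamma>" "wf_ty X \<Gamma> A" "i \<le> length \<Gamma>"
  shows "wf_ctx X (take i \<Gamma>) \<and> wf_ty X (take i \<Gamma>) ((map snd \<Gamma> @ [A]) ! i)"
proof (cases "i < length \<Gamma>")
  case True
  then have "\<Gamma> = take i \<Gamma> @ (fst (\<Gamma> ! i), snd (\<Gamma> ! i)) # drop (Suc i) \<Gamma>"
    using id_take_nth_drop by simp
  then show ?thesis
    using wf_ctx_declaration assms(1) True by (metis length_map nth_append nth_map)
next
  case False
  then show ?thesis using assms by (simp add: nth_append)
qed

text \<open>All type equalities along two telescopes being syntactic, each of them says that a type is obtained
from its counterpart by the renaming between the contexts. Jointly they say that this renaming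
carries one judgement to the other.\<close>

lemma telescope_eq_iff_rename:
  assumes X: "presheaf X" and D: "Weak \<in> D"
    and \<Gamma>: "wf_ctx X \<Gamma>" "wf_ty X \<Gamma> A" and \<Delta>: "wf_ctx X \<Delta>" "wf_ty X \<Delta> B"
    and \<sigma>: "ctx_vars \<Gamma> = map \<sigma> (ctx_vars \<Delta>)"
  shows "(\<forall>i \<le> length \<Gamma>.
      take i \<Gamma> \<turnstile> TypeEq ((map snd \<Gamma> @ [A]) ! i)
        (rename_vars (take i (ctx_vars \<Gamma>)) (take i (ctx_vars \<Delta>)) ((map snd \<Delta> @ [B]) ! i))
      \<in> derived D (free_gat X))
    \<longleftrightarrow> \<Gamma> \<turnstile> IsType A = map_judgement \<sigma> id (\<Delta> \<turnstile> IsType B)"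
proof -
  let ?f = "map_expr \<sigma> id :: ('a, 'b) fexpr \<Rightarrow> ('a, 'b) fexpr"
  have len: "length \<Gamma> = length \<Delta>"
    using arg_cong[OF \<sigma>, of length] by simp
  have tv: "take i (ctx_vars \<Delta>) = ctx_vars (take i \<Delta>)" for i
    by (simp add: ctx_vars_def take_map)
  have ren: "rename_vars (take i (ctx_vars \<Gamma>)) (take i (ctx_vars \<Delta>)) ((map snd \<Delta> @ [B]) ! i)
      = ?f ((map snd \<Delta> @ [B]) ! i)" if "i \<le> length \<Gamma>" for i
  proof -
    have "fv ((map snd \<Delta> @ [B]) ! i) \<subseteq> set (take i (ctx_vars \<Delta>))"
      using fv_wf_ty wf_telescope[OF \<Delta>] that len tv by metis
    then show ?thesis
      unfolding \<sigma> take_map by (rule rename_vars_eq_map_expr)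
  qed
  have "(\<forall>i \<le> length \<Gamma>.
      take i \<Gamma> \<turnstile> TypeEq ((map snd \<Gamma> @ [A]) ! i)
        (rename_vars (take i (ctx_vars \<Gamma>)) (take i (ctx_vars \<Delta>)) ((map snd \<Delta> @ [B]) ! i))
      \<in> derived D (free_gat X))
    \<longleftrightarrow> (\<forall>i \<le> length \<Gamma>. (map snd \<Gamma> @ [A]) ! i = ?f ((map snd \<Delta> @ [B]) ! i))"
    using wf_telescope[OF \<Gamma>] ren by (simp add: derived_iff_valid[OF X D])
  also have "\<dots> \<longleftrightarrow> map snd \<Gamma> @ [A] = map ?f (map snd \<Delta> @ [B])"
    unfolding list_eq_iff_nth_eq using len
    by (auto simp: less_Suc_eq_le nth_append simp del: map_append)
  also have "\<dots> \<longleftrightarrow> map snd \<Gamma> = map snd (map (map_prod \<sigma> ?f) \<Delta>) \<and> A = ?f B"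
    by simp
  also have "\<dots> \<longleftrightarrow> \<Gamma> = map (map_prod \<sigma> ?f) \<Delta> \<and> A = ?f B"
  proof -
    have "map fst \<Gamma> = map fst (map (map_prod \<sigma> ?f) \<Delta>)"
      using \<sigma> by (simp add: ctx_vars_def)
    then show ?thesis using zip_map_fst_snd by metis
  qed
  also have "\<dots> \<longleftrightarrow> \<Gamma> \<turnstile> IsType A = map_judgement \<sigma> id (\<Delta> \<turnstile> IsType B)"
    by simp
  finally show ?thesis .
qed

lemma ctx_vars_rename:
  "ctx_vars (judg_ctx (map_judgement \<sigma> id J)) = map \<sigma> (ctx_vars (judg_ctx J))"
  by (cases J) (simp add: ctx_vars_def)

text \<open>The classes are therefore orbits of the group of permutations of the variables. It acts on
judgements of every kind, which makes transitivity, symmetry and compatibility with boundaries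
immediate.\<close>

lemma ty_equiv_iff_alpha:
  assumes X: "presheaf X" and D: "Weak \<in> D"
  shows "(J, J') \<in> ty_equiv D (free_gat X)
    \<longleftrightarrow> J \<in> ty_valid X \<and> J' \<in> ty_valid X \<and> alpha_equiv J J'"
proof -
  have der: "\<Gamma> \<turnstile> IsType A \<in> derived D (free_gat X) \<longleftrightarrow> wf_ctx X \<Gamma> \<and> wf_ty X \<Gamma> A" for \<Gamma> A
    by (simp add: derived_iff_valid[OF X D])
  show ?thesis
  proof
    assume "(J, J') \<in> ty_equiv D (free_gat X)"
    then obtain \<Gamma> A \<Delta> B where J: "J = \<Gamma> \<turnstile> IsType A" "J' = \<Delta> \<turnstile> IsType B"
      and wf: "wf_ctx X \<Gamma>" "wf_ty X \<Gamma> A" "wf_ctx X \<Delta>" "wf_ty X \<Delta> B"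
      and len: "length \<Gamma> = length \<Delta>"
      and tel: "\<forall>i \<le> length \<Gamma>.
      take i \<Gamma> \<turnstile> TypeEq ((map snd \<Gamma> @ [A]) ! i)
        (rename_vars (take i (ctx_vars \<Gamma>)) (take i (ctx_vars \<Delta>)) ((map snd \<Delta> @ [B]) ! i))
      \<in> derived D (free_gat X)"
      unfolding ty_equiv_def Let_def der by blast
    obtain \<sigma> where \<sigma>: "bij \<sigma>" "map \<sigma> (ctx_vars \<Delta>) = ctx_vars \<Gamma>"
      using ex_permutation_map[of "ctx_vars \<Delta>" "ctx_vars \<Gamma>"] wf len distinct_wf_ctx by auto
    then show "J \<in> ty_valid X \<and> J' \<in> ty_valid X \<and> alpha_equiv J J'"
      using telescope_eq_iff_rename[OF X D wf \<sigma>(2)[symmetric]] tel wf J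
      unfolding ty_valid_def alpha_equiv_def by blast
  next
    assume "J \<in> ty_valid X \<and> J' \<in> ty_valid X \<and> alpha_equiv J J'"
    then obtain \<Gamma> A \<Delta> B \<sigma> where J: "J = \<Gamma> \<turnstile> IsType A" "J' = \<Delta> \<turnstile> IsType B"
      and wf: "wf_ctx X \<Gamma>" "wf_ty X \<Gamma> A" "wf_ctx X \<Delta>" "wf_ty X \<Delta> B"
      and eq: "J = map_judgement \<sigma> id J'"
      unfolding ty_valid_def alpha_equiv_def by blast
    have \<sigma>: "ctx_vars \<Gamma> = map \<sigma> (ctx_vars \<Delta>)"
      using ctx_vars_rename[of \<sigma> J'] eq J by simp
    have "length \<Gamma> = length \<Delta>"
      using arg_cong[OF \<sigma>, of length] by simp
    then show "(J, J') \<in> ty_equiv D (free_gat X)"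
      using telescope_eq_iff_rename[OF X D wf \<sigma>] eq wf
      unfolding ty_equiv_def Let_def der J by blast
  qed
qed

lemma tm_equiv_iff_alpha:
  assumes X: "presheaf X" and D: "Weak \<in> D"
  shows "(J, J') \<in> tm_equiv D (free_gat X)
    \<longleftrightarrow> J \<in> tm_valid D X \<and> J' \<in> tm_valid D X \<and> alpha_equiv J J'"
proof -
  have der: "\<Gamma> \<turnstile> HasType t A \<in> derived D (free_gat X)
      \<longleftrightarrow> wf_ctx X \<Gamma> \<and> wf_ty X \<Gamma> A \<and> wf_tm D X \<Gamma> t A"
    "\<Gamma> \<turnstile> TermEq t u A \<in> derived D (free_gat X)
      \<longleftrightarrow> wf_ctx X \<Gamma> \<and> wf_ty X \<Gamma> A \<and> wf_tm D X \<Gamma> t A \<and> t = u" for \<Gamma> t u A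
    by (simp_all add: derived_iff_valid[OF X D])
  have ren: "rename_vars (ctx_vars \<Gamma>) (ctx_vars \<Delta>) t = map_expr \<sigma> id t"
    if "\<Gamma> \<turnstile> IsType A = map_judgement \<sigma> id (\<Delta> \<turnstile> IsType B)"
      "wf_ctx X \<Delta>" "wf_ty X \<Delta> B" "wf_tm D X \<Delta> t B" for \<Gamma> A \<Delta> B t \<sigma>
  proof -
    have "ctx_vars \<Gamma> = map \<sigma> (ctx_vars \<Delta>)"
      using ctx_vars_rename[of \<sigma> "\<Delta> \<turnstile> IsType B"] that(1) by (metis judgement.sel(1))
    then show ?thesis
      using rename_vars_eq_map_expr[OF fv_wf_tm[OF that(2-4)]] by simp
  qed
  have split: "\<Gamma> \<turnstile> HasType s A = map_judgement \<sigma> id (\<Delta> \<turnstile> HasType t B)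
    \<longleftrightarrow> \<Gamma> \<turnstile> IsType A = map_judgement \<sigma> id (\<Delta> \<turnstile> IsType B) \<and> s = map_expr \<sigma> id t"
    for \<Gamma> \<Delta> :: "('a, 'b) fctx" and s A \<sigma> t B
    by auto
  show ?thesis
  proof
    assume "(J, J') \<in> tm_equiv D (free_gat X)"
    then obtain \<Gamma> s A \<Delta> t B where J: "J = \<Gamma> \<turnstile> HasType s A" "J' = \<Delta> \<turnstile> HasType t B"
      and wf: "wf_ctx X \<Gamma>" "wf_ty X \<Gamma> A" "wf_tm D X \<Gamma> s A"
        "wf_ctx X \<Delta>" "wf_ty X \<Delta> B" "wf_tm D X \<Delta> t B"
      and ty: "(\<Gamma> \<turnstile> IsType A, \<Delta> \<turnstile> IsType B) \<in> ty_equiv D (free_gat X)"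
      and tm: "s = rename_vars (ctx_vars \<Gamma>) (ctx_vars \<Delta>) t"
      unfolding tm_equiv_def der by blast
    obtain \<sigma> where \<sigma>: "bij \<sigma>" "\<Gamma> \<turnstile> IsType A = map_judgement \<sigma> id (\<Delta> \<turnstile> IsType B)"
      using ty unfolding ty_equiv_iff_alpha[OF X D] alpha_equiv_def by blast
    then have "J = map_judgement \<sigma> id J'"
      unfolding J split using ren wf tm by blast
    then show "J \<in> tm_valid D X \<and> J' \<in> tm_valid D X \<and> alpha_equiv J J'"
      using \<sigma>(1) wf J unfolding tm_valid_def alpha_equiv_def by blast
  next
    assume "J \<in> tm_valid D X \<and> J' \<in> tm_valid D X \<and> alpha_equiv J J'"
    then obtain \<Gamma> s A \<Delta> t B \<sigma> where J: "J = \<Gamma> \<turnstile> HasType s A" "J' = \<Delta> \<turnstile> HasType t B"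
      and wf: "wf_ctx X \<Gamma>" "wf_ty X \<Gamma> A" "wf_tm D X \<Gamma> s A"
        "wf_ctx X \<Delta>" "wf_ty X \<Delta> B" "wf_tm D X \<Delta> t B"
      and \<sigma>: "bij \<sigma>" "J = map_judgement \<sigma> id J'"
      unfolding tm_valid_def alpha_equiv_def by blast
    have eq: "\<Gamma> \<turnstile> IsType A = map_judgement \<sigma> id (\<Delta> \<turnstile> IsType B)" "s = map_expr \<sigma> id t"
      using \<sigma>(2) unfolding J split by blast+
    then have "(\<Gamma> \<turnstile> IsType A, \<Delta> \<turnstile> IsType B) \<in> ty_equiv D (free_gat X)"
      unfolding ty_equiv_iff_alpha[OF X D] alpha_equiv_def ty_valid_def using wf \<sigma>(1) by blast
    then show "(J, J') \<in> tm_equiv D (free_gat X)"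
      unfolding tm_equiv_def der J using wf eq ren[OF eq(1) wf(4-6)] by simp
  qed
qed

lemma ty_equiv_free:
  assumes "presheaf X" "Weak \<in> D"
  shows "ty_equiv D (free_gat X) = {(J, J'). J \<in> ty_valid X \<and> J' \<in> ty_valid X \<and> alpha_equiv J J'}"
  using ty_equiv_iff_alpha[OF assms] by auto

lemma ty_judgs_free:
  assumes "presheaf X" "Weak \<in> D"
  shows "ty_judgs D (free_gat X) n = {J \<in> ty_valid X. degree J = n}"
  by (auto simp: ty_judgs_def ty_valid_def derived_iff_valid[OF assms])

lemma tm_judgs_free:
  assumes "presheaf X" "Weak \<in> D"
  shows "tm_judgs D (free_gat X) n = {J \<in> tm_valid D X. degree J = n}"
  by (auto simp: tm_judgs_def tm_valid_def derived_iff_valid[OF assms])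

lemma alpha_class_eq_iff:
  assumes "J \<in> S" "J' \<in> S"
  shows "{K \<in> S. alpha_equiv J K} = {K \<in> S. alpha_equiv J' K} \<longleftrightarrow> alpha_equiv J J'"
proof
  assume "{K \<in> S. alpha_equiv J K} = {K \<in> S. alpha_equiv J' K}"
  then have "J' \<in> {K \<in> S. alpha_equiv J K}"
    using assms(2) alpha_equiv_refl by blast
  then show "alpha_equiv J J'" by blast
qed (use alpha_equiv_sym alpha_equiv_trans in blast)

lemma ty_class_eq_iff:
  assumes "presheaf X" "Weak \<in> D" "J \<in> ty_valid X" "J' \<in> ty_valid X"
  shows "ty_equiv D (free_gat X) `` {J} = ty_equiv D (free_gat X) `` {J'} \<longleftrightarrow> alpha_equiv J J'"
  using alpha_class_eq_iff[OF assms(3,4)] assms(3,4)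
  by (simp add: Image_singleton ty_equiv_iff_alpha[OF assms(1,2)])

lemma tm_class_eq_iff:
  assumes "presheaf X" "Weak \<in> D" "J \<in> tm_valid D X" "J' \<in> tm_valid D X"
  shows "tm_equiv D (free_gat X) `` {J} = tm_equiv D (free_gat X) `` {J'} \<longleftrightarrow> alpha_equiv J J'"
  using alpha_class_eq_iff[OF assms(3,4)] assms(3,4)
  by (simp add: Image_singleton tm_equiv_iff_alpha[OF assms(1,2)])

lemma ty_valid_rename: "J \<in> ty_valid X \<Longrightarrow> bij \<sigma> \<Longrightarrow> map_judgement \<sigma> id J \<in> ty_valid X"
  using wf_ctx_rename wf_ty_rename bij_is_inj unfolding ty_valid_def by fastforce

lemma tm_valid_rename: "J \<in> tm_valid D X \<Longrightarrow> bij \<sigma> \<Longrightarrow> map_judgement \<sigma> id J \<in> tm_valid D X"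
  using wf_ctx_rename wf_ty_rename wf_tm_rename bij_is_inj unfolding tm_valid_def by fastforce

lemma boundary_rename:
  "boundary (map_judgement \<sigma> id J) = map (map_judgement \<sigma> id) (boundary J)"
  by (induction J rule: boundary.induct) (auto simp: map_butlast last_map id_def)

text \<open>The boundary of a class may be computed on any representative, as renaming commutes with boundaries.\<close>

lemma boundary_class:
  assumes X: "presheaf X" "Weak \<in> D" and J: "J \<in> c" "boundary J = [J0]" "J0 \<in> ty_valid X"
    and c: "\<And>J'. J' \<in> c \<Longrightarrow> alpha_equiv J' J"
  shows "ty_equiv D (free_gat X) `` (\<Union>J\<in>c. set (boundary J)) = ty_equiv D (free_gat X) `` {J0}"
proof -
  have "\<exists>\<sigma>. bij \<sigma> \<and> boundary J' = [map_judgement \<sigma> id J0]" if "J' \<in> c" for J'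
    using c[OF that] J(2) unfolding alpha_equiv_def by (auto simp: boundary_rename)
  then have "ty_equiv D (free_gat X) `` {K} = ty_equiv D (free_gat X) `` {J0}"
    if "J' \<in> c" "K \<in> set (boundary J')" for J' K
    using ty_class_eq_iff[OF X _ J(3)] ty_valid_rename[OF J(3)] alpha_equiv_rename that
    by fastforce
  then show ?thesis using J(1,2) by fastforce
qed

lemma judg_vars_valid: "valid D X J \<Longrightarrow> judg_vars J \<subseteq> set (ctx_vars (judg_ctx J))"
proof -
  assume J: "valid D X J"
  obtain \<Gamma> R where "J = \<Gamma> \<turnstile> R" by (cases J)
  with J have \<Gamma>: "wf_ctx X \<Gamma>" and R: "rhs_vars R \<subseteq> set (ctx_vars \<Gamma>)"
    using fv_wf_ty fv_wf_tm by (cases R; fastforce)+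
  have "judg_vars J = ctx_fv \<Gamma> \<union> rhs_vars R"
    unfolding \<open>J = \<Gamma> \<turnstile> R\<close> by (induction \<Gamma>) (auto simp: ctx_fv_def)
  then show ?thesis
    using R ctx_fv_wf[OF \<Gamma>] \<open>J = \<Gamma> \<turnstile> R\<close> by simp
qed

text \<open>A renaming between judgements that declare the same variables in the same order fixes all variables
that occur, so an orbit has at most one member with prescribed context variables.\<close>

lemma alpha_equiv_same_vars:
  assumes "valid D X J'" "alpha_equiv J J'"
    "ctx_vars (judg_ctx J) = ctx_vars (judg_ctx J')"
  shows "J = J'"
proof -
  obtain \<sigma> where \<sigma>: "J = map_judgement \<sigma> id J'"
    using assms(2) unfolding alpha_equiv_def by blast
  have "map \<sigma> (ctx_vars (judg_ctx J')) = map id (ctx_vars (judg_ctx J'))"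
    using ctx_vars_rename[of \<sigma> J'] assms(3) \<sigma> by simp
  then have "\<sigma> v = id v" if "v \<in> judg_vars J'" for v
    using judg_vars_valid[OF assms(1)] that unfolding map_eq_conv by blast
  then have "J = map_judgement id id J'"
    unfolding \<sigma> by (rule judgement.map_cong0) auto
  then show ?thesis by (simp add: judgement.map_id del: id_apply)
qed

text \<open>Every orbit contains a judgement whose variables are numbered by their position, which is how the
judgements attached to heaps are written.\<close>

lemma ex_numbered_variant:
  assumes "valid D X J" "degree J = n"
  shows "\<exists>\<sigma>. bij \<sigma> \<and> ctx_vars (judg_ctx (map_judgement \<sigma> id J)) = [1..<n]"
proof -
  have "distinct (ctx_vars (judg_ctx J))"
    using assms(1) distinct_wf_ctx by (cases J; cases "judg_rhs J") auto
  moreover have "length (ctx_vars (judg_ctx J)) = length [1..<n]"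
    using assms(2) by (auto simp: degree_def)
  ultimately show ?thesis
    using ex_permutation_map[of "ctx_vars (judg_ctx J)" "[1..<n]"] unfolding ctx_vars_rename by simp
qed

section \<open>Heaps as numbered well-formed contexts\<close>

lemma Hp_less: "\<phi> \<in> Hp n \<Longrightarrow> i \<in> {1..n} \<Longrightarrow> \<phi> i < i"
  by (auto simp: Hp_def)

lemma Hp_zero: "\<phi> \<in> Hp n \<Longrightarrow> \<phi> 0 = 0"
  by (auto simp: Hp_def)

lemma Hp_parent: "\<phi> \<in> Hp n \<Longrightarrow> i \<in> {1..n} \<Longrightarrow> \<phi> i \<noteq> 0 \<Longrightarrow> \<phi> i \<in> {1..n}"
  using Hp_less[of \<phi> n i] by auto

lemma Hp_funpow_le: "\<phi> \<in> Hp n \<Longrightarrow> i \<le> n \<Longrightarrow> (\<phi> ^^ k) i \<le> i"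
proof (induction k arbitrary: i)
  case (Suc k)
  have "\<phi> i \<le> i"
    using Hp_less[OF Suc.prems(1), of i] Hp_zero[OF Suc.prems(1)] Suc.prems(2) by (cases "i = 0") auto
  then show ?case
    using Suc.IH[OF Suc.prems(1), of "\<phi> i"] Suc.prems(2) by (simp add: funpow_swap1)
qed simp

text \<open>Iterates of a heap decrease strictly until they reach 0, so the proper ancestors of a node are its
parent and, unless that is 0, the distinct proper ancestors of the parent.\<close>

lemma dp_rec:
  assumes "\<phi> \<in> Hp n" "i \<in> {1..n}"
  shows "dp \<phi> i = (if \<phi> i = 0 then 1 else Suc (dp \<phi> (\<phi> i)))"
proof -
  let ?S = "\<lambda>i. {(\<phi> ^^ k) i | k. k \<ge> 1}"
  have S: "?S i = insert (\<phi> i) (?S (\<phi> i))"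
  proof (intro set_eqI iffI)
    fix x assume "x \<in> ?S i"
    then obtain k where "x = (\<phi> ^^ Suc k) i" by (auto elim: less_natE simp: Suc_le_eq)
    then show "x \<in> insert (\<phi> i) (?S (\<phi> i))"
      by (cases k) (auto simp: funpow_Suc_right simp del: funpow.simps(2) intro: exI[of _ k])
  next
    fix x assume "x \<in> insert (\<phi> i) (?S (\<phi> i))"
    then consider "x = (\<phi> ^^ 1) i" | k where "x = (\<phi> ^^ Suc k) i"
      by (auto simp: funpow_swap1)
    then show "x \<in> ?S i" by cases (blast, force)
  qed
  have le: "\<phi> i \<le> n" using Hp_less[OF assms] assms(2) by auto
  show ?thesis
  proof (cases "\<phi> i = 0")
    case True
    have "(\<phi> ^^ k) 0 = 0" for k
      using Hp_funpow_le[OF assms(1), of 0 k] by simp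
    then have "?S i = {0}" unfolding S True by auto
    then show ?thesis using True by (simp add: dp_def)
  next
    case False
    have sub: "?S (\<phi> i) \<subseteq> {..<\<phi> i}"
    proof
      fix x assume "x \<in> ?S (\<phi> i)"
      then obtain k where x: "x = (\<phi> ^^ k) (\<phi> (\<phi> i))"
        by (auto elim: less_natE simp: Suc_le_eq funpow_swap1)
      have lt: "\<phi> (\<phi> i) < \<phi> i"
        using Hp_less[OF assms(1) Hp_parent[OF assms False]] .
      then have "x \<le> \<phi> (\<phi> i)"
        unfolding x using Hp_funpow_le[OF assms(1)] le by simp
      then show "x \<in> {..<\<phi> i}" using lt by simp
    qed
    then have "finite (?S (\<phi> i))" "\<phi> i \<notin> ?S (\<phi> i)"
      using finite_subset by blast+
    then show ?thesis using False unfolding dp_def S by simp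
  qed
qed

lemma dp_pos: "\<phi> \<in> Hp n \<Longrightarrow> i \<in> {1..n} \<Longrightarrow> dp \<phi> i \<ge> 1"
  using dp_rec by simp

lemma heap_args_rec:
  assumes "\<phi> \<in> Hp n" "i \<in> {1..n}"
  shows "heap_args \<phi> i = (if \<phi> i = 0 then [] else heap_args \<phi> (\<phi> i) @ [Var (\<phi> i)])"
proof (cases "\<phi> i = 0")
  case True
  then show ?thesis using dp_rec[OF assms] by (simp add: heap_args_def)
next
  case False
  let ?d = "dp \<phi> (\<phi> i)"
  have d: "dp \<phi> i = Suc ?d" "?d \<ge> 1"
    using dp_rec[OF assms] dp_pos[OF assms(1) Hp_parent[OF assms False]] False by auto
  have "(\<phi> ^^ (Suc ?d - l)) i = (\<phi> ^^ (?d - l)) (\<phi> i)" if "l < ?d" for l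
    using that by (simp add: Suc_diff_le funpow_swap1)
  then show ?thesis
    using d False by (simp add: heap_args_def)
qed

text \<open>The last argument at a node is its parent, and an empty list of arguments tells that the parent is 0;
so the arguments at a node determine its parent.\<close>

lemma heap_args_inject:
  assumes "\<phi> \<in> Hp n" "i \<in> {1..n}" "\<phi>' \<in> Hp n'" "i' \<in> {1..n'}"
    and "heap_args \<phi> i = heap_args \<phi>' i'"
  shows "\<phi> i = \<phi>' i'"
  using assms(5) unfolding heap_args_rec[OF assms(1,2)] heap_args_rec[OF assms(3,4)]
  by (simp split: if_splits)

lemma heap_ctx_Suc: "n \<ge> 1 \<Longrightarrow> heap_ctx (Suc n) \<phi> h = heap_ctx n \<phi> h @ [(n, heap_ty \<phi> h n)]"
  by (simp add: heap_ctx_def)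

lemma heap_ctx_1 [simp]: "heap_ctx (Suc 0) \<phi> h = []"
  by (simp add: heap_ctx_def)

lemma ctx_vars_heap_ctx [simp]: "ctx_vars (heap_ctx n \<phi> h) = [1..<n]"
  by (simp add: heap_ctx_def ctx_vars_def comp_def)

text \<open>The declaration sought by \<^const>\<open>wf_ty\<close> is that of the parent node: it carries the right head symbol
because \<open>h\<close> commutes with boundaries, and the right arguments because the ancestors of a node are its
parent and the ancestors of the parent.\<close>

lemma wf_heap_ty:
  assumes "(\<phi>, h) \<in> heap_maps n X" "i \<in> {1..n}"
  shows "wf_ty X (heap_ctx i \<phi> h) (heap_ty \<phi> h i)"
proof -
  obtain f g where h: "h = (f, g)" by fastforce
  have \<phi>: "\<phi> \<in> Hp n" and hom: "(f, g) \<in> psh_hom (heap_psh n \<phi>) X"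
    using assms(1) by (auto simp: heap_maps_def h)
  have el: "at_node \<phi> h i \<in> ty_el X (dp \<phi> i)"
    using hom assms(2) by (auto simp: psh_hom_def heap_psh_def at_node_def h PiE_iff)
  show ?thesis
  proof (cases "\<phi> i = 0")
    case True
    then have "dp \<phi> i = Suc 0" "heap_args \<phi> i = ([] :: ('a, 'b) fexpr list)"
      using dp_rec[OF \<phi> assms(2)] heap_args_rec[OF \<phi> assms(2)] by simp_all
    then show ?thesis
      using wf_ty.root el by (simp add: heap_ty_def)
  next
    case False
    let ?j = "dp \<phi> (\<phi> i)"
    have p: "\<phi> i \<in> {1..n}" and lt: "\<phi> i < i" and j: "?j \<ge> 1" and di: "dp \<phi> i = Suc ?j"
      using Hp_parent[OF \<phi> assms(2) False] Hp_less[OF \<phi> assms(2)] dp_pos[OF \<phi>]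
        dp_rec[OF \<phi> assms(2)] False by auto
    have bd: "ty_bd X ?j (at_node \<phi> h i) = at_node \<phi> h (\<phi> i)"
      using hom assms(2) j di by (auto simp: psh_hom_def heap_psh_def at_node_def h)
    have "(\<phi> i, heap_ty \<phi> h (\<phi> i)) \<in> set (heap_ctx i \<phi> h)"
      using p lt by (auto simp: heap_ctx_def)
    then have "(\<phi> i, App (Inl (?j, ty_bd X ?j (at_node \<phi> h i))) (heap_args \<phi> (\<phi> i)))
        \<in> set (heap_ctx i \<phi> h)"
      unfolding bd heap_ty_def[of \<phi> h "\<phi> i"] .
    from wf_ty.child[OF _ j this] show ?thesis
      using el False di by (simp add: heap_ty_def heap_args_rec[OF \<phi> assms(2)])
  qed
qed

lemma wf_heap_ctx:
  assumes "(\<phi>, h) \<in> heap_maps n X" "i \<in> {1..n}"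
  shows "wf_ctx X (heap_ctx i \<phi> h)"
proof -
  have "i \<ge> 1" "i \<le> n" using assms(2) by auto
  then show ?thesis
  proof (induction i rule: dec_induct)
    case base
    then show ?case by (simp add: wf_ctx.nil)
  next
    case (step i)
    then show ?case using wf_heap_ty[OF assms(1), of i] by (simp add: heap_ctx_Suc)
  qed
qed

definition heap_judg :: "nat \<Rightarrow> (nat \<Rightarrow> nat) \<times> ('a, 'b) heap_map \<Rightarrow> ('a, 'b) fjudg" where
  "heap_judg n = (\<lambda>(\<phi>, h). heap_ctx n \<phi> h \<turnstile> IsType (heap_ty \<phi> h n))"

lemma heap_judg_valid: "n \<ge> 1 \<Longrightarrow> x \<in> heap_maps n X \<Longrightarrow> heap_judg n x \<in> ty_valid X"
  using wf_heap_ctx[of _ _ n X n] wf_heap_ty[of _ _ n X n]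
  by (cases x) (auto simp: heap_judg_def ty_valid_def)

lemma degree_heap_judg: "n \<ge> 1 \<Longrightarrow> degree (heap_judg n x) = n"
  by (cases x) (simp add: heap_judg_def degree_def heap_ctx_def)

lemma heap_judg_inject:
  assumes "x \<in> heap_maps n X" "x' \<in> heap_maps n X" "n \<ge> 1" "heap_judg n x = heap_judg n x'"
  shows "x = x'"
proof -
  obtain \<phi> f g \<phi>' f' g' where x: "x = (\<phi>, f, g)" "x' = (\<phi>', f', g')"
    by (metis prod_cases3)
  have \<phi>: "\<phi> \<in> Hp n" "\<phi>' \<in> Hp n"
    and hom: "(f, g) \<in> psh_hom (heap_psh n \<phi>) X" "(f', g') \<in> psh_hom (heap_psh n \<phi>') X"
    using assms(1,2) by (auto simp: heap_maps_def x)
  have "heap_ty \<phi> (f, g) i = heap_ty \<phi>' (f', g') i" if "i \<in> {1..n}" for i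
    using assms(4) that by (cases "i = n") (auto simp: heap_judg_def heap_ctx_def x)
  then have eq: "dp \<phi> i = dp \<phi>' i" "f (dp \<phi> i) i = f' (dp \<phi>' i) i" "\<phi> i = \<phi>' i"
    if "i \<in> {1..n}" for i
    using heap_args_inject[OF \<phi>(1) that \<phi>(2) that] that
    unfolding heap_ty_def at_node_def fst_conv expr.inject sum.inject prod.inject by blast+
  have "\<phi> i = \<phi>' i" if "i \<in> {0..n}" for i
    using eq(3)[of i] Hp_zero[OF \<phi>(1)] Hp_zero[OF \<phi>(2)] that by (cases "i = 0") auto
  then have "\<phi> = \<phi>'"
    using \<phi> by (intro PiE_ext[of \<phi> "{0..n}" "\<lambda>_. {0..n}" \<phi>']) (auto simp: Hp_def)
  moreover have "f m = f' m" for m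
  proof (rule PiE_ext)
    show "f m \<in> {i \<in> {1..n}. dp \<phi> i = m} \<rightarrow>\<^sub>E ty_el X m" "f' m \<in> {i \<in> {1..n}. dp \<phi> i = m} \<rightarrow>\<^sub>E ty_el X m"
      using hom by (simp_all add: psh_hom_def heap_psh_def \<open>\<phi> = \<phi>'\<close>)
  qed (use eq in fastforce)
  moreover have "g m = g' m" for m
    using hom by (simp add: psh_hom_def heap_psh_def)
  ultimately show ?thesis by (simp add: x fun_eq_iff)
qed

text \<open>The inverse construction: send a position to the last argument of its type, or to 0 if there is none,
and let \<open>h\<close> pick the head symbols. Depth and arguments in this heap agree with the index and the
arguments found in the context, by induction along parents.\<close>

lemma ex_heap_of_ctx:
  fixes X :: "('a, 'b) psh"
  assumes "wf_ctx X \<Gamma>" "wf_ty X \<Gamma> A" "ctx_vars \<Gamma> = [1..<n]" "n \<ge> 1"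
  shows "\<exists>x\<in>heap_maps n X. heap_judg n x = \<Gamma> \<turnstile> IsType A"
proof -
  \<comment> \<open>Positions count from 1; position \<open>n\<close> holds the type on the right of the judgement.\<close>
  define T where "T i = (map snd \<Gamma> @ [A]) ! (i - 1)" for i
  have len: "length \<Gamma> = n - 1"
    using arg_cong[OF assms(3), of length] by simp
  have pre: "take (i - 1) \<Gamma> = map (\<lambda>j. (j, T j)) [1..<i]" if "i \<in> {1..n}" for i
  proof (rule nth_equalityI)
    fix k assume "k < length (take (i - 1) \<Gamma>)"
    then have k: "k < i - 1" "k < length \<Gamma>" by auto
    have "fst (\<Gamma> ! k) = Suc k"
      using k len arg_cong[OF assms(3), of "\<lambda>xs. xs ! k"] by (simp add: ctx_vars_def)
    then show "take (i - 1) \<Gamma> ! k = map (\<lambda>j. (j, T j)) [1..<i] ! k"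
      using k by (simp add: T_def nth_append prod_eq_iff)
  qed (use that len in auto)
  have wf: "wf_ty X (map (\<lambda>j. (j, T j)) [1..<i]) (T i)" if "i \<in> {1..n}" for i
    using wf_telescope[OF assms(1,2), of "i - 1"] that len pre[OF that] by (auto simp: T_def)
  have \<Gamma>: "\<Gamma> = map (\<lambda>j. (j, T j)) [1..<n]" and A: "A = T n"
    using pre[of n] len assms(4) by (simp_all add: T_def nth_append)
  have "\<exists>K a es p. T i = App (Inl (K, a)) es \<and> a \<in> ty_el X K \<and>
      (p = 0 \<and> es = [] \<and> K = 1 \<or>
       p \<in> {1..<i} \<and> (\<exists>j us. K = Suc j \<and> j \<ge> 1 \<and> T p = App (Inl (j, ty_bd X j a)) us
         \<and> es = us @ [Var p]))" if "i \<in> {1..n}" for i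
    using wf[OF that]
  proof cases
    case (root a)
    then show ?thesis by auto
  next
    case (child a j v us)
    then have "v \<in> {1..<i}" "T v = App (Inl (j, ty_bd X j a)) us" by auto
    then show ?thesis using child(1-3) by blast
  qed
  then obtain K a es p where node: "\<And>i. i \<in> {1..n} \<Longrightarrow>
      T i = App (Inl (K i, a i)) (es i) \<and> a i \<in> ty_el X (K i) \<and>
      (p i = 0 \<and> es i = [] \<and> K i = 1 \<or>
       p i \<in> {1..<i} \<and> (\<exists>j us. K i = Suc j \<and> j \<ge> 1 \<and> T (p i) = App (Inl (j, ty_bd X j (a i))) us
         \<and> es i = us @ [Var (p i)]))"
    by metis
  have inner: "p i \<in> {1..n}" "K i = Suc (K (p i))" "K (p i) \<ge> 1"
      "a (p i) = ty_bd X (K (p i)) (a i)" "es i = es (p i) @ [Var (p i)]"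
    if "i \<in> {1..n}" "p i \<noteq> 0" for i
  proof -
    have "p i \<in> {1..n}" using node[OF that(1)] that by auto
    then show "p i \<in> {1..n}" "K i = Suc (K (p i))" "K (p i) \<ge> 1"
      "a (p i) = ty_bd X (K (p i)) (a i)" "es i = es (p i) @ [Var (p i)]"
      using node[OF that(1)] node[of "p i"] that(2) by auto
  qed
  define \<phi> where "\<phi> = restrict (\<lambda>i. if i = 0 then 0 else p i) {0..n}"
  have plt: "p i < i" if "i \<in> {1..n}" for i
    using node[OF that] that by auto
  have \<phi>p: "\<phi> i = p i" if "i \<in> {1..n}" for i
    using that by (simp add: \<phi>_def)
  have \<phi>: "\<phi> \<in> Hp n"
  proof -
    have "p i \<le> n" if "i \<in> {1..n}" for i
      using plt[OF that] that by auto
    then show ?thesis using plt by (auto simp: Hp_def \<phi>_def)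
  qed
  have dpK: "dp \<phi> i = K i \<and> heap_args \<phi> i = es i" if "i \<in> {1..n}" for i
    using that
  proof (induction i rule: less_induct)
    case (less i)
    show ?case
    proof (cases "p i = 0")
      case True
      then show ?thesis
        using node[OF less.prems] \<phi>p[OF less.prems]
        by (auto simp: dp_rec[OF \<phi> less.prems] heap_args_rec[OF \<phi> less.prems])
    next
      case False
      note q = inner[OF less.prems False]
      show ?thesis
        using less.IH[OF plt[OF less.prems] q(1)] q \<phi>p[OF less.prems] False
        by (simp add: dp_rec[OF \<phi> less.prems] heap_args_rec[OF \<phi> less.prems])
    qed
  qed
  define f where "f m = restrict a {i \<in> {1..n}. dp \<phi> i = m}" for m
  \<comment> \<open>The heap has no term-elements, and the only extensional function on the empty set is
    constantly \<open>undefined\<close>.\<close>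
  define g where "g m = (\<lambda>_ :: unit. undefined :: 'b)" for m :: nat
  have "(f, g) \<in> psh_hom (heap_psh n \<phi>) X"
  proof -
    have "f m \<in> {i \<in> {1..n}. dp \<phi> i = m} \<rightarrow>\<^sub>E ty_el X m" for m
      using node dpK by (auto simp: f_def)
    moreover have "f m (\<phi> i) = ty_bd X m (f (Suc m) i)"
      if "m \<ge> 1" "i \<in> {1..n}" "dp \<phi> i = Suc m" for m i
    proof -
      have "p i \<noteq> 0" using that(1,3) dp_rec[OF \<phi> that(2)] \<phi>p[OF that(2)]
        by (cases "p i = 0") auto
      note q = inner[OF that(2) this]
      have "K (p i) = m" using q(2) dpK[OF that(2)] that(3) by simp
      then show ?thesis
        using q dpK[OF q(1)] \<phi>p[OF that(2)] that by (simp add: f_def)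
    qed
    ultimately show ?thesis
      by (simp add: psh_hom_def heap_psh_def g_def PiE_iff extensional_def)
  qed
  then have mem: "(\<phi>, f, g) \<in> heap_maps n X"
    using \<phi> by (simp add: heap_maps_def)
  have "heap_ty \<phi> (f, g) i = T i" if "i \<in> {1..n}" for i
    using that dpK[OF that] node[OF that] by (simp add: heap_ty_def at_node_def f_def)
  then have "heap_judg n (\<phi>, f, g) = \<Gamma> \<turnstile> IsType A"
    using assms(4) by (auto simp: heap_judg_def heap_ctx_def \<Gamma> A)
  then show ?thesis using mem by blast
qed

lemma alpha_equiv_ex_heap:
  assumes "J \<in> ty_valid X" "degree J = n" "n \<ge> 1"
  shows "\<exists>x\<in>heap_maps n X. alpha_equiv (heap_judg n x) J"
proof -
  have "valid {} X J" using assms(1) by (auto simp: ty_valid_def)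
  from ex_numbered_variant[OF this assms(2)] obtain \<sigma> where
    \<sigma>: "bij \<sigma>" "ctx_vars (judg_ctx (map_judgement \<sigma> id J)) = [1..<n]" by blast
  obtain \<Gamma> A where J: "map_judgement \<sigma> id J = \<Gamma> \<turnstile> IsType A" "wf_ctx X \<Gamma>" "wf_ty X \<Gamma> A"
    using ty_valid_rename[OF assms(1) \<sigma>(1)] by (auto simp: ty_valid_def)
  then have "ctx_vars \<Gamma> = [1..<n]" using \<sigma>(2) by simp
  from ex_heap_of_ctx[OF J(2,3) this assms(3)] obtain x
    where "x \<in> heap_maps n X" "heap_judg n x = map_judgement \<sigma> id J" unfolding J(1) by blast
  then show ?thesis using alpha_equiv_rename[OF \<sigma>(1)] by metis
qed

lemma heap_judg_alpha_inject:
  assumes "x \<in> heap_maps n X" "x' \<in> heap_maps n X" "n \<ge> 1"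
    "alpha_equiv (heap_judg n x) (heap_judg n x')"
  shows "x = x'"
proof (rule heap_judg_inject[OF assms(1-3)])
  show "heap_judg n x = heap_judg n x'"
  proof (rule alpha_equiv_same_vars[OF _ assms(4)])
    show "valid {} X (heap_judg n x')"
      using heap_judg_valid[OF assms(3,2)] by (auto simp: ty_valid_def)
  qed (cases x; cases x'; simp add: heap_judg_def)
qed

text \<open>Parents of nodes up to \<open>n\<close> are again at most \<open>n\<close>, so restricting the heap changes neither depth nor
arguments of these nodes.\<close>

lemma boundary_heap_judg:
  assumes "x \<in> heap_maps (Suc n) X" "n \<ge> 1"
  shows "boundary (heap_judg (Suc n) x) = [heap_judg n (heap_bd n x)]"
proof -
  obtain \<phi> h where x: "x = (\<phi>, h)" by (metis surj_pair)
  have \<phi>: "\<phi> \<in> Hp (Suc n)" using assms(1) by (auto simp: x heap_maps_def)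
  let ?\<phi> = "restrict \<phi> {0..n}" and ?h = "restrict_hom (heap_psh n (restrict \<phi> {0..n})) h"
  have pow: "(?\<phi> ^^ k) i = (\<phi> ^^ k) i" if "i \<le> n" for i k
  proof (induction k)
    case (Suc k)
    have "(\<phi> ^^ k) i \<le> n" using Hp_funpow_le[OF \<phi>, of i k] that by simp
    then show ?case using Suc by simp
  qed simp
  have dp: "dp ?\<phi> i = dp \<phi> i" if "i \<le> n" for i
    using pow[OF that] by (simp add: dp_def)
  have args: "heap_args ?\<phi> i = heap_args \<phi> i" if "i \<le> n" for i
    using pow[OF that] dp[OF that] by (simp add: heap_args_def)
  have "at_node ?\<phi> ?h i = at_node \<phi> h i" if "i \<in> {1..n}" for i
    using that dp[of i] by (simp add: at_node_def restrict_hom_def heap_psh_def)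
  then have "heap_ty ?\<phi> ?h i = heap_ty \<phi> h i" if "i \<in> {1..n}" for i
    using that dp[of i] args[of i] by (simp add: heap_ty_def)
  then have "heap_ctx n ?\<phi> ?h = heap_ctx n \<phi> h" "heap_ty ?\<phi> ?h n = heap_ty \<phi> h n"
    using assms(2) by (auto simp: heap_ctx_def)
  then show ?thesis
    using assms(2) by (simp add: x heap_judg_def heap_bd_def Let_def heap_ctx_Suc)
qed

section \<open>The two monads\<close>

lemma ty_ident_eq: "ty_ident D X n x = ty_equiv D (free_gat X) `` {heap_judg n x}"
  by (cases x) (simp add: ty_ident_def heap_judg_def)

text \<open>Each class contains exactly one numbered judgement, and numbered judgements are heaps.\<close>

lemma bij_betw_ty_ident:
  assumes X: "presheaf X" and D: "Weak \<in> D" and n: "n \<ge> 1"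
  shows "bij_betw (ty_ident D X n) (heap_maps n X) (ty_el (free_forget D X) n)"
proof -
  note cls = ty_class_eq_iff[OF X D]
  have el: "ty_el (free_forget D X) n = {J \<in> ty_valid X. degree J = n} // ty_equiv D (free_gat X)"
    by (simp add: free_forget_def forget_def ty_judgs_free[OF X D])
  show ?thesis
    unfolding bij_betw_def el
  proof (intro conjI inj_onI equalityI subsetI)
    fix x x' assume "x \<in> heap_maps n X" "x' \<in> heap_maps n X" "ty_ident D X n x = ty_ident D X n x'"
    then show "x = x'"
      using heap_judg_alpha_inject[OF _ _ n] cls heap_judg_valid[OF n] by (metis ty_ident_eq)
  next
    fix c assume "c \<in> ty_ident D X n ` heap_maps n X"
    then show "c \<in> {J \<in> ty_valid X. degree J = n} // ty_equiv D (free_gat X)"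
      using heap_judg_valid[OF n] degree_heap_judg[OF n] by (auto simp: ty_ident_eq intro!: quotientI)
  next
    fix c assume "c \<in> {J \<in> ty_valid X. degree J = n} // ty_equiv D (free_gat X)"
    then obtain J where J: "J \<in> ty_valid X" "degree J = n" "c = ty_equiv D (free_gat X) `` {J}"
      by (auto elim: quotientE)
    then obtain x where "x \<in> heap_maps n X" "alpha_equiv (heap_judg n x) J"
      using alpha_equiv_ex_heap n by blast
    then show "c \<in> ty_ident D X n ` heap_maps n X"
      using cls[OF heap_judg_valid[OF n] J(1)] J(3) ty_ident_eq[of D X n x] by blast
  qed
qed

lemma ty_bd_ty_ident:
  assumes X: "presheaf X" and D: "Weak \<in> D" and n: "n \<ge> 1" and x: "x \<in> heap_maps (Suc n) X"
  shows "ty_bd (free_forget D X) n (ty_ident D X (Suc n) x) = ty_ident D X n (heap_bd n x)"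
proof -
  have v: "heap_judg (Suc n) x \<in> ty_valid X"
    using heap_judg_valid[OF _ x] by simp
  have "heap_judg n (heap_bd n x) \<in> ty_valid X"
  proof -
    obtain \<phi> h where x: "x = (\<phi>, h)" by (metis surj_pair)
    have "wf_ctx X (butlast (heap_ctx (Suc n) \<phi> h)) \<and> wf_ty X (butlast (heap_ctx (Suc n) \<phi> h))
      (snd (last (heap_ctx (Suc n) \<phi> h)))"
      using v n by (auto simp: heap_judg_def ty_valid_def x heap_ctx_Suc)
    moreover have "heap_ctx (Suc n) \<phi> h \<noteq> []" using n by (simp add: heap_ctx_Suc)
    then have "heap_judg n (heap_bd n x)
        = butlast (heap_ctx (Suc n) \<phi> h) \<turnstile> IsType (snd (last (heap_ctx (Suc n) \<phi> h)))"
      using boundary_heap_judg[OF assms(4) n] by (simp add: heap_judg_def[of "Suc n"] x)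
    ultimately show ?thesis
      unfolding ty_valid_def by blast
  qed
  then show ?thesis
    unfolding free_forget_def forget_def ty_ident_eq psh.simps
    by (intro boundary_class[OF X D _ boundary_heap_judg[OF x n]])
      (auto simp: ty_equiv_iff_alpha[OF X D] v alpha_equiv_refl intro: alpha_equiv_sym)
qed

definition heap_tm :: "(nat \<Rightarrow> nat) \<Rightarrow> nat \<Rightarrow> 'b + nat \<Rightarrow> ('a, 'b) fexpr" where
  "heap_tm \<phi> n z = (case z of Inl a \<Rightarrow> App (Inr (dp \<phi> n, a)) (heap_args \<phi> n) | Inr i \<Rightarrow> Var i)"

text \<open>Projection contributes the variables declared with the type of the judgement itself. Two nodes of a
heap have equal types precisely when they have the same parent and the same label: equal parents
give equal depths and arguments, and the last argument gives back the parent.\<close>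

lemma wf_tm_heap_iff:
  fixes X :: "('a, 'b) psh"
  assumes x: "(\<phi>, h) \<in> heap_maps n X" and n: "n \<ge> 1" and D: "Proj \<in> D"
  shows "wf_tm D X (heap_ctx n \<phi> h) t (heap_ty \<phi> h n) \<longleftrightarrow>
    t \<in> heap_tm \<phi> n ` (Tm X (dp \<phi> n) (at_node \<phi> h n)
      <+> {i \<in> {1..n - 1}. \<phi> n = \<phi> i \<and> at_node \<phi> h n = at_node \<phi> h i})"
proof -
  have \<phi>: "\<phi> \<in> Hp n" using x by (auto simp: heap_maps_def)
  have nn: "n \<in> {1..n}" using n by simp
  have same: "heap_ty \<phi> h n = heap_ty \<phi> h i \<longleftrightarrow> \<phi> n = \<phi> i \<and> at_node \<phi> h n = at_node \<phi> h i"
    if "i \<in> {1..n - 1}" for i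
  proof -
    have i: "i \<in> {1..n}" using that by auto
    have "dp \<phi> n = dp \<phi> i" "heap_args \<phi> n = (heap_args \<phi> i :: ('a, 'b) fexpr list)"
      if "\<phi> n = \<phi> i"
      unfolding dp_rec[OF \<phi> nn] dp_rec[OF \<phi> i] heap_args_rec[OF \<phi> nn] heap_args_rec[OF \<phi> i] that
      by simp_all
    then show ?thesis
      using heap_args_inject[OF \<phi> nn \<phi> i] unfolding heap_ty_def by blast
  qed
  have decl: "(i, heap_ty \<phi> h n) \<in> set (heap_ctx n \<phi> h)
      \<longleftrightarrow> i \<in> {1..n - 1} \<and> \<phi> n = \<phi> i \<and> at_node \<phi> h n = at_node \<phi> h i" for i
    using same[of i] by (auto simp: heap_ctx_def)
  have "wf_tm D X (heap_ctx n \<phi> h) t (heap_ty \<phi> h n) \<longleftrightarrow>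
      (\<exists>a\<in>Tm X (dp \<phi> n) (at_node \<phi> h n). t = heap_tm \<phi> n (Inl a)) \<or>
      (\<exists>i. (i, heap_ty \<phi> h n) \<in> set (heap_ctx n \<phi> h) \<and> t = heap_tm \<phi> n (Inr i))"
    by (subst wf_tm.simps) (use D in \<open>auto simp: heap_ty_def heap_tm_def Tm_def\<close>)
  then show ?thesis unfolding decl by (auto simp: Plus_def image_Un image_iff)
qed

text \<open>A class over the type class of a heap has a representative whose context and type are literally those
of the heap: rename any member by a permutation that does this to its boundary. What remains is the
term, which is unique because the context variables are now fixed.\<close>

lemma bij_betw_tm_ident:
  assumes X: "presheaf X" and D: "Weak \<in> D" "Proj \<in> D" and n: "n \<ge> 1"
    and x: "(\<phi>, h) \<in> heap_maps n X"
  shows "bij_betw (tm_ident D X n \<phi> h)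
    (Tm X (dp \<phi> n) (at_node \<phi> h n)
      <+> {i \<in> {1..n - 1}. \<phi> n = \<phi> i \<and> at_node \<phi> h n = at_node \<phi> h i})
    (Tm (free_forget D X) n (ty_ident D X n (\<phi>, h)))" (is "bij_betw _ ?Z _")
proof -
  let ?E = "tm_equiv D (free_gat X)"
  define J where "J t = heap_ctx n \<phi> h \<turnstile> HasType t (heap_ty \<phi> h n)" for t
  have ident: "tm_ident D X n \<phi> h z = ?E `` {J (heap_tm \<phi> n z)}" for z
    by (simp add: tm_ident_def J_def heap_tm_def)
  have nn: "n \<in> {1..n}" using n by simp
  have Jv: "J t \<in> tm_valid D X \<longleftrightarrow> t \<in> heap_tm \<phi> n ` ?Z" for t
    using wf_heap_ctx[OF x nn] wf_heap_ty[OF x nn] wf_tm_heap_iff[OF x n D(2)]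
    by (simp add: J_def tm_valid_def)
  have deg: "degree (J t) = n" for t
    using degree_heap_judg[OF n, of "(\<phi>, h)"] by (simp add: J_def heap_judg_def degree_def)
  have bdJ: "boundary (J t) = [heap_judg n (\<phi>, h)]" for t
    by (simp add: J_def heap_judg_def)
  have bd: "tm_bd (free_forget D X) n (?E `` {K}) = ty_equiv D (free_gat X) `` {K0}"
    if "K \<in> tm_valid D X" "boundary K = [K0]" "K0 \<in> ty_valid X" for K K0
    unfolding free_forget_def forget_def psh.simps
    by (intro boundary_class[OF X D(1) _ that(2,3)])
      (auto simp: tm_equiv_iff_alpha[OF X D(1)] that(1) alpha_equiv_refl intro: alpha_equiv_sym)
  have inj: "inj_on (heap_tm \<phi> n :: _ \<Rightarrow> ('a, 'b) fexpr) ?Z"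
    by (auto simp: inj_on_def heap_tm_def split: sum.splits)
  show ?thesis
    unfolding bij_betw_def
  proof (intro conjI inj_onI equalityI subsetI)
    fix z z' assume z: "z \<in> ?Z" "z' \<in> ?Z" "tm_ident D X n \<phi> h z = tm_ident D X n \<phi> h z'"
    then have v: "J (heap_tm \<phi> n z) \<in> tm_valid D X" "J (heap_tm \<phi> n z') \<in> tm_valid D X"
      using Jv by blast+
    have "valid D X (J (heap_tm \<phi> n z'))"
      using v(2) by (auto simp: tm_valid_def)
    then have "J (heap_tm \<phi> n z) = J (heap_tm \<phi> n z')"
    proof (rule alpha_equiv_same_vars)
      show "alpha_equiv (J (heap_tm \<phi> n z)) (J (heap_tm \<phi> n z'))"
        using z(3) tm_class_eq_iff[OF X D(1) v] by (simp add: ident)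
    qed (simp add: J_def)
    then show "z = z'" using inj z(1,2) by (simp add: J_def inj_on_def)
  next
    fix c assume "c \<in> tm_ident D X n \<phi> h ` ?Z"
    then obtain z where z: "z \<in> ?Z" "c = ?E `` {J (heap_tm \<phi> n z)}" by (auto simp: ident)
    have v: "J (heap_tm \<phi> n z) \<in> tm_valid D X" using Jv z(1) by blast
    have "c \<in> tm_el (free_forget D X) n"
      using v deg by (auto simp: z(2) free_forget_def forget_def tm_judgs_free[OF X D(1)] intro!: quotientI)
    moreover have "tm_bd (free_forget D X) n c = ty_ident D X n (\<phi>, h)"
      using bd[OF v bdJ heap_judg_valid[OF n x]] by (simp add: z(2) ty_ident_eq)
    ultimately show "c \<in> Tm (free_forget D X) n (ty_ident D X n (\<phi>, h))"
      by (simp add: Tm_def)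
  next
    fix c assume "c \<in> Tm (free_forget D X) n (ty_ident D X n (\<phi>, h))"
    then have c: "c \<in> {J \<in> tm_valid D X. degree J = n} // ?E"
      "tm_bd (free_forget D X) n c = ty_equiv D (free_gat X) `` {heap_judg n (\<phi>, h)}"
      by (simp_all add: Tm_def free_forget_def forget_def tm_judgs_free[OF X D(1)] ty_ident_eq)
    then obtain K where K: "K \<in> tm_valid D X" "c = ?E `` {K}" by (auto elim: quotientE)
    then obtain \<Gamma> t A where K': "K = \<Gamma> \<turnstile> HasType t A" "\<Gamma> \<turnstile> IsType A \<in> ty_valid X"
      by (auto simp: tm_valid_def ty_valid_def)
    have "ty_equiv D (free_gat X) `` {\<Gamma> \<turnstile> IsType A} = ty_equiv D (free_gat X) `` {heap_judg n (\<phi>, h)}"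
      using bd[OF K(1) _ K'(2)] K' c(2) K(2) by simp
    then have "alpha_equiv (heap_judg n (\<phi>, h)) (\<Gamma> \<turnstile> IsType A)"
      using ty_class_eq_iff[OF X D(1) K'(2) heap_judg_valid[OF n x]] alpha_equiv_sym by blast
    then obtain \<sigma> where \<sigma>: "bij \<sigma>" "heap_judg n (\<phi>, h) = map_judgement \<sigma> id (\<Gamma> \<turnstile> IsType A)"
      unfolding alpha_equiv_def by blast
    have eq: "map_judgement \<sigma> id K = J (map_expr \<sigma> id t)"
      using \<sigma>(2) by (simp add: K'(1) J_def heap_judg_def)
    then have v: "J (map_expr \<sigma> id t) \<in> tm_valid D X"
      using tm_valid_rename[OF K(1) \<sigma>(1)] by simp
    then obtain z where z: "z \<in> ?Z" "map_expr \<sigma> id t = heap_tm \<phi> n z"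
      using Jv by blast
    have "alpha_equiv (J (heap_tm \<phi> n z)) K"
      using alpha_equiv_rename[OF \<sigma>(1), of K] eq z(2) by simp
    moreover have "J (heap_tm \<phi> n z) \<in> tm_valid D X"
      using v z(2) by simp
    ultimately have "c = tm_ident D X n \<phi> h z"
      unfolding ident K(2) using tm_class_eq_iff[OF X D(1) _ K(1)] by blast
    then show "c \<in> tm_ident D X n \<phi> h ` ?Z" using z(1) by blast
  qed
qed

theorem proposition25:
  fixes X :: "('a, 'b) psh"
  assumes "presheaf X"
  shows "(\<forall>n\<ge>1. ty_el (monad_P X) n = ty_el (monad_W X) n) \<and>
    (\<forall>n\<ge>1. \<forall>c\<in>ty_el (monad_P X) (Suc n). ty_bd (monad_P X) n c = ty_bd (monad_W X) n c) \<and>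
    (\<forall>D\<in>{{Weak}, {Weak, Proj}}. \<forall>n\<ge>1.
       bij_betw (ty_ident D X n) (heap_maps n X) (ty_el (free_forget D X) n)) \<and>
    (\<forall>D\<in>{{Weak}, {Weak, Proj}}. \<forall>n\<ge>1. \<forall>x\<in>heap_maps (Suc n) X.
       ty_bd (free_forget D X) n (ty_ident D X (Suc n) x) = ty_ident D X n (heap_bd n x)) \<and>
    (\<forall>n\<ge>1. \<forall>(\<phi>, h)\<in>heap_maps n X.
       bij_betw (tm_ident {Weak, Proj} X n \<phi> h)
         (Tm X (dp \<phi> n) (at_node \<phi> h n)
            <+> {i \<in> {1..n - 1}. \<phi> n = \<phi> i \<and> at_node \<phi> h n = at_node \<phi> h i})
         (Tm (monad_P X) n (ty_ident {Weak, Proj} X n (\<phi>, h))))"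
proof (intro conjI)
  have equiv: "ty_equiv {Weak, Proj} (free_gat X) = ty_equiv {Weak} (free_gat X)"
    using ty_equiv_free[OF assms] by simp
  have judgs: "ty_judgs {Weak, Proj} (free_gat X) = ty_judgs {Weak} (free_gat X)"
    using ty_judgs_free[OF assms] by (simp add: fun_eq_iff)
  show "\<forall>n\<ge>1. ty_el (monad_P X) n = ty_el (monad_W X) n"
    and "\<forall>n\<ge>1. \<forall>c\<in>ty_el (monad_P X) (Suc n). ty_bd (monad_P X) n c = ty_bd (monad_W X) n c"
    by (simp_all add: free_forget_def forget_def equiv judgs)
  show "\<forall>D\<in>{{Weak}, {Weak, Proj}}. \<forall>n\<ge>1.
      bij_betw (ty_ident D X n) (heap_maps n X) (ty_el (free_forget D X) n)"
    using bij_betw_ty_ident[OF assms] by blast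
  show "\<forall>D\<in>{{Weak}, {Weak, Proj}}. \<forall>n\<ge>1. \<forall>x\<in>heap_maps (Suc n) X.
      ty_bd (free_forget D X) n (ty_ident D X (Suc n) x) = ty_ident D X n (heap_bd n x)"
    using ty_bd_ty_ident[OF assms] by blast
  show "\<forall>n\<ge>1. \<forall>(\<phi>, h)\<in>heap_maps n X.
       bij_betw (tm_ident {Weak, Proj} X n \<phi> h)
         (Tm X (dp \<phi> n) (at_node \<phi> h n)
            <+> {i \<in> {1..n - 1}. \<phi> n = \<phi> i \<and> at_node \<phi> h n = at_node \<phi> h i})
         (Tm (monad_P X) n (ty_ident {Weak, Proj} X n (\<phi>, h)))"
    using bij_betw_tm_ident[OF assms] by blast
qed

end
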